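(* Let $G$ be a locally compact group with neutral element $e$ and let $f:[-1,1]\times G\to\mathbb{C}$ be a continuous function. Then $f$ belongs to $\mathcal{P}(\mathbb{S}^\infty,G)$ if and only if there exists a sequence $(\varphi_n)_{n\ge0}$ of functions from $\mathcal{P}(G)$ with $\sum_{n=0}^\infty\varphi_n(e)<\infty$ such that $$f(\cos\theta,u)=\sum_{n=0}^\infty \varphi_n(u)\cos^n\theta,\qquad \theta\in[0,\pi],\ u\in G.$$ This expansion is uniformly convergent for $(\theta,u)\in[0,\pi]\times G$. Moreover, for $f\in\mathcal{P}(\mathbb{S}^\infty,G)$, the $d$-Schoenberg functions $\varphi_{n,d}$ of $f$ satisfy $$\lim_{d\to\infty}\varphi_{n,d}(u)=\varphi_n(u)\qquad\text{for all }(n,u)\in\mathbb{N}_0\times G.$$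
   Context: $\mathbb{N}=\{1,2,\ldots\}$, $\mathbb{N}_0=\{0,1,2,\ldots\}$. A function $\varphi:G\to\mathbb{C}$ is positive definite if for all $n\in\mathbb{N}$ and $u_1,\ldots,u_n\in G$ the matrix $[\varphi(u_k^{-1}u_l)]_{k,l=1}^n$ is (hermitian) positive semidefinite; $\mathcal{P}(G)$ is the set of continuous positive definite functions on $G$. For $d\in\mathbb{N}$, $\mathbb{S}^d$ is the unit sphere of $\mathbb{R}^{d+1}$ and $\xi\cdot\eta$ is the Euclidean scalar product. $\mathcal{P}(\mathbb{S}^d,G)$ is the set of continuous functions $f:[-1,1]\times G\to\mathbb{C}$ such that for all $n\in\mathbb{N}$ and all $(\xi_1,u_1),\ldots,(\xi_n,u_n)\in\mathbb{S}^d\times G$ the matrix $[f(\xi_k\cdot\xi_l,u_k^{-1}u_l)]_{k,l=1}^n$ is positive semidefinite, i.e. $\sum_{k,l=1}^n f(\xi_k\cdot\xi_l,u_k^{-1}u_l)a_k\overline{a_l}\ge 0$ for all $(a_1,\ldots,a_n)\in\mathbb{C}^n$. Define $\mathcal{P}(\mathbb{S}^\infty,G)=\bigcap_{d=1}^\infty\mathcal{P}(\mathbb{S}^d,G)$ (equivalently, the same definition with $\mathbb{S}^d$ replaced by the unit sphere $\mathbb{S}^\infty$ of the real Hilbert space $\ell_2$). For $f\in\mathcal{P}(\mathbb{S}^d,G)$, $d\in\mathbb{N}$, the $d$-Schoenberg functions of $f$ are $$\varphi_{n,d}(u)=\frac{N_n(d)\,\sigma_{d-1}}{\sigma_d}\int_{-1}^1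 f(x,u)\,c_n(d,x)\,(1-x^2)^{d/2-1}\,dx,\quad n\ge 0,\ u\in G;$$ they are the coefficient functions in the expansion $f(x,u)=\sum_{n=0}^\infty\varphi_{n,d}(u)c_n(d,x)$. Here, for $\lambda>0$, the Gegenbauer polynomials $C_n^{(\lambda)}$ are given by $(1-2xr+r^2)^{-\lambda}=\sum_{n=0}^\infty C_n^{(\lambda)}(x)r^n$, $|r|<1$; $c_n(d,x)=C_n^{((d-1)/2)}(x)/C_n^{((d-1)/2)}(1)$ for $d\ge 2$, and $c_n(1,x)=T_n(x)=\cos(n\arccos x)$. $N_n(d)=\frac{(d)_{n-1}}{n!}(2n+d-1)$ for $n\ge1$, $N_0(d)=1$, where $(a)_n=a(a+1)\cdots(a+n-1)$ for $n\ge 1$ and $(a)_0=1$. $\sigma_d=\frac{2\pi^{(d+1)/2}}{\Gamma((d+1)/2)}$, and $\sigma_0=2$. *)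

theory Defs
  imports "HOL-Analysis.Analysis" "HOL-Algebra.Group"
begin

text \<open>No separation axiom is part of the definition; Hausdorff groups are a special case.\<close>

locale locally_compact_group = group G
  for G :: "('a, 'b) monoid_scheme" (structure) +
  fixes T :: "'a topology"
  assumes topspace_eq: "topspace T = carrier G"
    and continuous_mult: "continuous_map (prod_topology T T) T (\<lambda>(x, y). x \<otimes> y)"
    and continuous_inv: "continuous_map T T (\<lambda>x. inv x)"
    and locally_compact: "locally_compact_space T"


section \<open>Positive definite functions\<close>

text \<open>Over the complex numbers, requiring the quadratic form to be real and nonnegative
  already forces the matrix to be hermitian.\<close>

definition psd_matrix :: "nat \<Rightarrow> (nat \<Rightarrow> nat \<Rightarrow> complex) \<Rightarrow> bool" where
  "psd_matrix n A \<longleftrightarrow> (\<forall>a. (\<Sum>k<n. \<Sum>l<n. A k l * a k * cnj (a l)) \<in> \<real>\<^sub>\<ge>\<^sub>0)"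

definition pos_def :: "('a, 'b) monoid_scheme \<Rightarrow> 'a topology \<Rightarrow> ('a \<Rightarrow> complex) set" where
  "pos_def G T = {\<phi>. continuous_map T euclidean \<phi> \<and>
     (\<forall>n\<ge>1. \<forall>u. (\<forall>k<n. u k \<in> carrier G) \<longrightarrow>
        psd_matrix n (\<lambda>k l. \<phi> (inv\<^bsub>G\<^esub> u k \<otimes>\<^bsub>G\<^esub> u l)))}"

text \<open>A point of \<^term>\<open>topspace (nsphere d)\<close> is a unit vector of (d+1)-dimensional Euclidean
  space, encoded as a sequence whose entries of index greater than d vanish.\<close>

definition pos_def_sphere ::
    "nat \<Rightarrow> ('a, 'b) monoid_scheme \<Rightarrow> 'a topology \<Rightarrow> (real \<times> 'a \<Rightarrow> complex) set" where
  "pos_def_sphere d G T =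
     {f. continuous_map (prod_topology (top_of_set {-1..1}) T) euclidean f \<and>
       (\<forall>n\<ge>1. \<forall>\<xi> u. (\<forall>k<n. \<xi> k \<in> topspace (nsphere d) \<and> u k \<in> carrier G) \<longrightarrow>
          psd_matrix n (\<lambda>k l. f (\<Sum>i\<le>d. \<xi> k i * \<xi> l i, inv\<^bsub>G\<^esub> u k \<otimes>\<^bsub>G\<^esub> u l)))}"

definition pos_def_sphere_inf ::
    "('a, 'b) monoid_scheme \<Rightarrow> 'a topology \<Rightarrow> (real \<times> 'a \<Rightarrow> complex) set" where
  "pos_def_sphere_inf G T = (\<Inter>d\<in>{1..}. pos_def_sphere d G T)"


section \<open>Gegenbauer polynomials\<close>

text \<open>Defined pointwise by the generating function; the defining condition is meaningful for
  \<open>\<bar>x\<bar> \<le> 1\<close> only, which is where the polynomials are evaluated. Existence and uniqueness of the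
  coefficients there are shown below.\<close>

definition gegenbauer :: "real \<Rightarrow> nat \<Rightarrow> real \<Rightarrow> real" where
  "gegenbauer lam n x =
     (THE C. \<forall>r. \<bar>r\<bar> < 1 \<longrightarrow> (\<lambda>n. C n * r ^ n) sums ((1 - 2 * x * r + r\<^sup>2) powr (- lam))) n"

lemma gegenbauer_ex:
  fixes x lam :: real
  assumes "\<bar>x\<bar> \<le> 1"
  shows "\<exists>C. \<forall>r. \<bar>r\<bar> < 1 \<longrightarrow> (\<lambda>n. C n * r ^ n) sums ((1 - 2 * x * r + r\<^sup>2) powr (- lam))"
proof -
  define w where "w = cis (arccos x)"
  have norm_w: "norm w = 1" by (simp add: w_def)
  have Re_w: "Re w = x" using assms by (simp add: w_def)
  define g where "g = (\<lambda>n. (complex_of_real (- lam) gchoose n) * (- w) ^ n)"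
  define C where "C = (\<lambda>n. Re (\<Sum>i\<le>n. g i * cnj (g (n - i))))"
  have "(\<lambda>n. C n * r ^ n) sums ((1 - 2 * x * r + r\<^sup>2) powr (- lam))" if r: "\<bar>r\<bar> < 1" for r
  proof -
    let ?R = "complex_of_real r"
    let ?z = "1 - w * ?R"
    let ?a = "\<lambda>n. g n * ?R ^ n"
    have nr: "norm (- w * ?R) < 1" using r by (simp add: norm_mult norm_w)
    have s: "?a sums (?z powr complex_of_real (- lam))"
    proof -
      have "(\<lambda>n. (complex_of_real (- lam) gchoose n) * (- w * ?R) ^ n) = ?a"
        by (simp only: g_def power_mult_distrib mult.assoc)
      moreover have "1 + - w * ?R = ?z" by simp
      ultimately show ?thesis
        using gen_binomial_complex[OF nr, of "complex_of_real (- lam)"] by (simp only:)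
    qed
    have rad: "summable (\<lambda>n. norm (?a n))"
    proof -
      have "ereal (norm ?R) < conv_radius (\<lambda>n. complex_of_real (- lam) gchoose n)"
        using r by (subst conv_radius_gchoose) auto
      from abs_summable_in_conv_radius[OF this] show ?thesis
        by (simp add: g_def norm_mult norm_power norm_w)
    qed
    have Re_pos: "Re ?z > 0"
    proof -
      have "x * r \<le> \<bar>x\<bar> * \<bar>r\<bar>" by (metis abs_ge_self abs_mult)
      also have "\<dots> \<le> 1 * \<bar>r\<bar>" using assms by (intro mult_right_mono) auto
      also have "\<dots> < 1" using r by simp
      finally show ?thesis by (simp add: Re_w)
    qed
    hence nz: "?z \<noteq> 0" by (metis less_irrefl zero_complex.sel(1))
    have rad': "summable (\<lambda>n. norm (cnj (?a n)))" using rad by (simp only: complex_mod_cnj)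
    have "(\<lambda>n. \<Sum>i\<le>n. ?a i * cnj (?a (n - i))) sums ((\<Sum>n. ?a n) * (\<Sum>n. cnj (?a n)))"
      by (rule Cauchy_product_sums[OF rad rad'])
    also have "(\<Sum>n. ?a n) = ?z powr complex_of_real (- lam)"
      using s by (simp add: sums_iff)
    also have "(\<Sum>n. cnj (?a n)) = cnj (?z powr complex_of_real (- lam))"
      using s sums_cnj sums_unique by metis
    also have "?z powr complex_of_real (- lam) * cnj (?z powr complex_of_real (- lam))
        = complex_of_real ((norm (?z powr complex_of_real (- lam)))\<^sup>2)"
      by (simp only: complex_norm_square)
    finally have 1: "(\<lambda>n. Re (\<Sum>i\<le>n. ?a i * cnj (?a (n - i)))) sums
        (norm (?z powr complex_of_real (- lam)))\<^sup>2"
      using sums_Re by fastforce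
    have "norm (?z powr complex_of_real (- lam)) = norm ?z powr (- lam)"
      by (subst norm_powr_real_powr') auto
    hence "(norm (?z powr complex_of_real (- lam)))\<^sup>2 = ((norm ?z)\<^sup>2) powr (- lam)"
      using nz by (simp add: powr_power powr_powr mult.commute flip: powr_numeral)
    also have "(norm ?z)\<^sup>2 = 1 - 2 * x * r + r\<^sup>2"
    proof -
      have "(Re w)\<^sup>2 + (Im w)\<^sup>2 = 1" using norm_w by (simp add: cmod_def)
      hence "r\<^sup>2 * (Re w)\<^sup>2 + r\<^sup>2 * (Im w)\<^sup>2 = r\<^sup>2" by (metis distrib_left mult.right_neutral)
      thus ?thesis unfolding cmod_power2
        by (simp add: Re_w power2_eq_square algebra_simps)
    qed
    finally have 2: "(norm (?z powr complex_of_real (- lam)))\<^sup>2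
        = (1 - 2 * x * r + r\<^sup>2) powr (- lam)" .
    have 3: "Re (\<Sum>i\<le>n. ?a i * cnj (?a (n - i))) = C n * r ^ n" for n
    proof -
      have "(\<Sum>i\<le>n. ?a i * cnj (?a (n - i))) = (\<Sum>i\<le>n. g i * cnj (g (n - i)) * of_real (r ^ n))"
        by (intro sum.cong) (auto simp: mult_ac simp flip: power_add)
      also have "\<dots> = (\<Sum>i\<le>n. g i * cnj (g (n - i))) * of_real (r ^ n)"
        by (simp only: sum_distrib_right)
      finally show ?thesis by (simp add: C_def del: of_real_power)
    qed
    from 1 show ?thesis unfolding 2 3 .
  qed
  thus ?thesis by blast
qed

lemma gegenbauer_sums:
  fixes x r lam :: real
  assumes "\<bar>x\<bar> \<le> 1" and "\<bar>r\<bar> < 1"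
  shows "(\<lambda>n. gegenbauer lam n x * r ^ n) sums ((1 - 2 * x * r + r\<^sup>2) powr (- lam))"
proof -
  let ?P = "\<lambda>C. \<forall>r. \<bar>r\<bar> < 1 \<longrightarrow> (\<lambda>n. C n * r ^ n) sums ((1 - 2 * x * r + r\<^sup>2) powr (- lam))"
  have uniq: "C = D" if C: "?P C" and D: "?P D" for C D :: "nat \<Rightarrow> real"
  proof -
    have "C n - D n = 0" for n
    proof (induction n rule: less_induct)
      case (less n)
      have "(\<lambda>k. (C (k + n) - D (k + n)) * r ^ k) sums 0" if r: "r \<noteq> 0" "\<bar>r\<bar> < 1" for r
      proof -
        have "(\<lambda>k. (C k - D k) * r ^ k) sums 0"
          using sums_diff[OF C[rule_format, OF r(2)] D[rule_format, OF r(2)]]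
          by (simp add: left_diff_distrib)
        hence "(\<lambda>k. (C (k + n) - D (k + n)) * r ^ (k + n)) sums 0"
          using less by (subst sums_iff_shift) simp
        from sums_mult[OF this, of "1 / r ^ n"] show ?thesis
          using r by (simp add: power_add)
      qed
      hence "((\<lambda>_::real. 0) \<longlongrightarrow> C (0 + n) - D (0 + n)) (at 0)"
        by (intro powser_limit_0_strong[of 1]) auto
      thus ?case by (simp add: tendsto_const_iff)
    qed
    thus ?thesis by auto
  qed
  have "\<exists>!C. ?P C" using gegenbauer_ex[OF assms(1)] uniq by blast
  from theI'[OF this] assms(2) show ?thesis unfolding gegenbauer_def by blast
qed

definition c_poly :: "nat \<Rightarrow> nat \<Rightarrow> real \<Rightarrow> real" where
  "c_poly n d x =
     (if d = 1 then cos (real n * arccos x)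
      else gegenbauer ((real d - 1) / 2) n x / gegenbauer ((real d - 1) / 2) n 1)"


section \<open>Schoenberg functions\<close>

definition harmonic_dim :: "nat \<Rightarrow> nat \<Rightarrow> real" where
  "harmonic_dim n d =
     (if n = 0 then 1
      else pochhammer (real d) (n - 1) / fact n * (2 * real n + real d - 1))"

definition sphere_area :: "nat \<Rightarrow> real" where
  "sphere_area d = 2 * pi powr ((real d + 1) / 2) / Gamma ((real d + 1) / 2)"

lemma sphere_area_0: "sphere_area 0 = 2"
  by (simp add: sphere_area_def Gamma_one_half_real powr_half_sqrt)

text \<open>Meaningful for \<open>d \<ge> 1\<close>. The weight takes the value 0 at \<open>x = \<plusminus>1\<close> because \<open>0 powr a = 0\<close>,
  which does not affect the integral.\<close>

definition schoenberg_fun :: "(real \<times> 'a \<Rightarrow> complex) \<Rightarrow> nat \<Rightarrow> nat \<Rightarrow> 'a \<Rightarrow> complex" where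
  "schoenberg_fun f n d u =
     of_real (harmonic_dim n d * sphere_area (d - 1) / sphere_area d) *
     integral {-1..1}
       (\<lambda>x. f (x, u) * of_real (c_poly n d x) * of_real ((1 - x\<^sup>2) powr (real d / 2 - 1)))"

text \<open>Since \<^term>\<open>\<phi> n \<one>\<^bsub>G\<^esub>\<close> is real and nonnegative for positive definite \<open>\<phi> n\<close>,
  summability expresses finiteness of the sum.\<close>

definition schoenberg_expansion ::
    "('a, 'b) monoid_scheme \<Rightarrow> 'a topology \<Rightarrow> (real \<times> 'a \<Rightarrow> complex) \<Rightarrow>
     (nat \<Rightarrow> 'a \<Rightarrow> complex) \<Rightarrow> bool" where
  "schoenberg_expansion G T f \<phi> \<longleftrightarrow>
     (\<forall>n. \<phi> n \<in> pos_def G T) \<and>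
     summable (\<lambda>n. \<phi> n \<one>\<^bsub>G\<^esub>) \<and>
     (\<forall>\<theta>\<in>{0..pi}. \<forall>u\<in>carrier G.
        (\<lambda>n. \<phi> n u * of_real (cos \<theta> ^ n)) sums f (cos \<theta>, u))"

end

theory Submission
  imports Defs
begin

text \<open>If \<open>f\<close> is positive definite on all spheres, restrict it to the vertices of the cube
  \<open>{-1, 1}\<^sup>N / \<surd>N\<close> in the unit sphere. The cube is a group, and testing the quadratic form against
  its characters shows that the Walsh coefficients of \<open>f\<close> are positive definite functions on \<open>G\<close>.
  Their sum over all characters of degree \<open>n\<close> is the coefficient of \<open>x\<^sup>n\<close> in the \<open>N\<close>-th Bernstein
  polynomial of \<open>f(\<cdot>, u)\<close> on \<open>[-1, 1]\<close>. These polynomials converge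
  to \<open>f\<close>, and since their coefficients are uniformly bounded, the coefficients converge as well;
  the limits are the functions \<open>\<phi>\<^sub>n\<close>. Conversely, \<open>\<phi>\<^sub>n(u) x\<^sup>n\<close> is positive definite because a power of
  a Gram matrix may be multiplied entrywise into a positive semidefinite matrix.

  For the Schoenberg functions, the recurrences of the Gegenbauer polynomials and of the moments
  of the weight give the coefficient of \<open>c\<^sub>n(d, \<cdot>)\<close> in \<open>x\<^sup>m\<close> in closed form. It lies in \<open>[0, 1]\<close>
  for large \<open>d\<close> and tends to \<open>1\<close> if \<open>m = n\<close> and to \<open>0\<close> otherwise, so the limit may be taken
  termwise in \<open>f(x, u) = \<Sum>\<^sub>m \<phi>\<^sub>m(u) x\<^sup>m\<close>.\<close>

section \<open>Positive semidefinite matrices and positive definite functions\<close>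

text \<open>Once the lower coefficients are known to vanish in the limit, dividing the series by
  \<open>x ^ j\<close> leaves \<open>c j i\<close> plus a tail of size O(x), uniformly in
  \<open>i\<close>. The filter is arbitrary because the lemma serves twice: along pairs of indices,
  to get a Cauchy sequence, and along points of the group, to get continuity.\<close>

lemma power_series_coeffs_tendsto_0:
  fixes c :: "nat \<Rightarrow> 'i \<Rightarrow> complex"
  assumes bound: "\<forall>\<^sub>F i in F. \<forall>j. norm (c j i) \<le> C"
    and lim: "\<And>x. 0 < x \<Longrightarrow> x < 1 \<Longrightarrow> ((\<lambda>i. \<Sum>j. c j i * of_real x ^ j) \<longlongrightarrow> 0) F"
  shows "(c j \<longlongrightarrow> 0) F"
proof (induction j rule: less_induct)
  case (less j)
  show ?case
  proof (rule tendstoI)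
    fix e :: real assume e: "e > 0"
    define D where "D = max C 1"
    \<comment> \<open>With \<open>x \<le> 1 / 2\<close> the geometric series is at most 2, so the
      tail is at most \<open>2 * D * x\<close>; the other bound makes this at most
      \<open>e / 4\<close>.\<close>
    define x where "x = min (1 / 2) (e / (8 * D))"
    have D: "D \<ge> 1" "C \<le> D" by (auto simp: D_def)
    have x: "0 < x" "x \<le> 1 / 2" using e D by (auto simp: x_def)
    have "x \<le> e / (8 * D)" by (simp add: x_def)
    hence xD: "2 * D * x \<le> e / 4" using D by (simp add: field_simps)
    \<comment> \<open>\<open>R i\<close> is the series without its first \<open>j\<close> terms,
      divided by \<open>x ^ j\<close>. For this fixed \<open>x\<close> it tends to 0 by
      \<open>lim\<close> and the induction hypothesis.\<close>
    define R where "R = (\<lambda>i. ((\<Sum>k. c k i * of_real x ^ k) - (\<Sum>k<j. c k i * of_real x ^ k)) / of_real x ^ j)"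
    have "((\<lambda>i. \<Sum>k<j. c k i * of_real x ^ k) \<longlongrightarrow> (\<Sum>k<j. 0 * of_real x ^ k)) F"
      using less by (intro tendsto_intros) auto
    hence "(R \<longlongrightarrow> (0 - (\<Sum>k<j. 0 * of_real x ^ k)) / of_real x ^ j) F"
      unfolding R_def using lim[of x] x by (intro tendsto_divide tendsto_diff tendsto_const) auto
    hence "(R \<longlongrightarrow> 0) F" by simp
    hence "\<forall>\<^sub>F i in F. dist (R i) 0 < e / 2" using e by (intro tendstoD) auto
    thus "\<forall>\<^sub>F i in F. dist (c j i) 0 < e" using bound
    proof eventually_elim
      case (elim i)
      have cD: "norm (c k i) \<le> D" for k using elim(2) D by (meson order_trans)
      have geo: "summable (\<lambda>k. D * x ^ k)" using x by (intro summable_mult summable_geometric) auto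
      have sm: "summable (\<lambda>k. c (k + m) i * of_real x ^ k)" for m
        by (rule summable_comparison_test'[OF geo, of 0])
           (use x cD in \<open>auto simp: norm_mult norm_power intro!: mult_right_mono\<close>)
      have "(\<Sum>k. c k i * of_real x ^ k) - (\<Sum>k<j. c k i * of_real x ^ k) =
          (\<Sum>k. c (k + j) i * of_real x ^ (k + j))"
        using suminf_minus_initial_segment[OF sm[of 0], of j] by simp
      also have "\<dots> = (\<Sum>k. c (k + j) i * of_real x ^ k * of_real x ^ j)"
        by (simp add: power_add mult.assoc)
      also have "\<dots> = (\<Sum>k. c (k + j) i * of_real x ^ k) * of_real x ^ j"
        by (rule suminf_mult2[OF sm, symmetric])
      finally have "R i = (\<Sum>k. c (k + j) i * of_real x ^ k)" using x by (simp add: R_def)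
      also have "\<dots> = c j i + (\<Sum>k. c (Suc k + j) i * of_real x ^ Suc k)"
        using suminf_split_head[OF sm[of j]] by simp
      also have "(\<Sum>k. c (Suc k + j) i * of_real x ^ Suc k) =
          (\<Sum>k. c (k + Suc j) i * of_real x ^ k) * of_real x"
        using suminf_mult2[OF sm[of "Suc j"], of "of_real x"] by (simp add: mult_ac)
      finally have cR: "c j i = R i - (\<Sum>k. c (k + Suc j) i * of_real x ^ k) * of_real x" by simp
      have "norm (\<Sum>k. c (k + Suc j) i * of_real x ^ k) \<le> (\<Sum>k. D * x ^ k)"
        by (rule norm_suminf_le[OF _ geo])
           (use x cD in \<open>auto simp: norm_mult norm_power intro!: mult_right_mono\<close>)
      also have "\<dots> \<le> 2 * D"
        using x D by (subst suminf_mult) (auto simp: suminf_geometric divide_simps)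
      finally have "norm ((\<Sum>k. c (k + Suc j) i * of_real x ^ k) * of_real x) \<le> 2 * D * x"
        using x D by (simp only: norm_mult norm_of_real) (intro mult_mono; simp)
      hence "norm (c j i) \<le> norm (R i) + 2 * D * x"
        unfolding cR by (intro norm_triangle_le_diff) simp
      thus ?case using elim(1) xD e by simp
    qed
  qed
qed

section \<open>Positive semidefinite matrices\<close>

lemma sum_in_nonneg_Reals:
  "(\<And>i. i \<in> I \<Longrightarrow> f i \<in> \<real>\<^sub>\<ge>\<^sub>0) \<Longrightarrow> sum f I \<in> (\<real>\<^sub>\<ge>\<^sub>0 :: complex set)"
  by (induction I rule: infinite_finite_induct) auto

lemma psd_matrix_sum:
  assumes "\<And>i. i \<in> I \<Longrightarrow> psd_matrix n (A i)"
  shows "psd_matrix n (\<lambda>k l. \<Sum>i\<in>I. A i k l)"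
  unfolding psd_matrix_def
proof
  fix a
  have "(\<Sum>k<n. \<Sum>l<n. (\<Sum>i\<in>I. A i k l) * a k * cnj (a l)) =
      (\<Sum>i\<in>I. \<Sum>k<n. \<Sum>l<n. A i k l * a k * cnj (a l))"
    unfolding sum_distrib_right
    by (subst sum.swap[of _ I]) (intro sum.cong refl sum.swap)
  also have "\<dots> \<in> \<real>\<^sub>\<ge>\<^sub>0"
    by (rule sum_in_nonneg_Reals) (use assms in \<open>simp add: psd_matrix_def\<close>)
  finally show "(\<Sum>k<n. \<Sum>l<n. (\<Sum>i\<in>I. A i k l) * a k * cnj (a l)) \<in> \<real>\<^sub>\<ge>\<^sub>0" .
qed

lemma psd_matrix_limit:
  assumes psd: "\<And>N. psd_matrix n (A N)"
    and lim: "\<And>k l. k < n \<Longrightarrow> l < n \<Longrightarrow> (\<lambda>N. A N k l) \<longlonglongrightarrow> B k l"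
  shows "psd_matrix n B"
  unfolding psd_matrix_def
proof
  fix a
  have "(\<lambda>N. \<Sum>k<n. \<Sum>l<n. A N k l * a k * cnj (a l)) \<longlonglongrightarrow> (\<Sum>k<n. \<Sum>l<n. B k l * a k * cnj (a l))"
    using lim by (intro tendsto_sum tendsto_mult tendsto_const) auto
  moreover have "\<And>N. (\<Sum>k<n. \<Sum>l<n. A N k l * a k * cnj (a l)) \<in> \<real>\<^sub>\<ge>\<^sub>0"
    using psd by (simp add: psd_matrix_def)
  ultimately show "(\<Sum>k<n. \<Sum>l<n. B k l * a k * cnj (a l)) \<in> \<real>\<^sub>\<ge>\<^sub>0"
    by (rule closed_sequentially[OF closed_nonneg_Reals_complex, rotated])
qed

text \<open>A case of the Schur product theorem with an elementary proof: a Gram matrix is a sum of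
  rank one matrices, and an entrywise product with a real rank one matrix only rescales the test
  vector.\<close>

lemma psd_matrix_mult_gram_power:
  assumes "psd_matrix n A"
  shows "psd_matrix n (\<lambda>k l. A k l * of_real ((\<Sum>i\<le>d. \<xi> k i * \<xi> l i) ^ m))"
proof (induction m)
  case 0
  thus ?case using assms by simp
next
  case (Suc m)
  let ?B = "\<lambda>k l. A k l * of_real ((\<Sum>i\<le>d. \<xi> k i * \<xi> l i) ^ m)"
  have "psd_matrix n (\<lambda>k l. ?B k l * of_real (\<xi> k i * \<xi> l i))" for i
    unfolding psd_matrix_def
  proof
    fix a
    show "(\<Sum>k<n. \<Sum>l<n. ?B k l * of_real (\<xi> k i * \<xi> l i) * a k * cnj (a l)) \<in> \<real>\<^sub>\<ge>\<^sub>0"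
      using Suc[unfolded psd_matrix_def, rule_format, of "\<lambda>k. of_real (\<xi> k i) * a k"]
      by (simp add: mult_ac)
  qed
  hence "psd_matrix n (\<lambda>k l. \<Sum>i\<le>d. ?B k l * of_real (\<xi> k i * \<xi> l i))"
    by (intro psd_matrix_sum)
  moreover have "(\<Sum>i\<le>d. ?B k l * of_real (\<xi> k i * \<xi> l i)) =
      A k l * of_real ((\<Sum>i\<le>d. \<xi> k i * \<xi> l i) ^ Suc m)" for k l
    unfolding sum_distrib_left[symmetric] of_real_sum[symmetric] power_Suc of_real_mult by simp
  ultimately show ?case by (simp only:)
qed

text \<open>Positive definiteness is stated for points numbered from 0; an enumeration carries it
  over to quadratic forms indexed by any finite set, here by pairs of a cube vertex and a group
  index.\<close>

lemma psd_matrix_family: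
  fixes K :: "'i \<Rightarrow> 'i \<Rightarrow> complex"
  assumes "finite I"
    and psd: "\<And>n g. n \<ge> 1 \<Longrightarrow> (\<forall>k<n. g k \<in> I) \<Longrightarrow> psd_matrix n (\<lambda>k l. K (g k) (g l))"
  shows "(\<Sum>i\<in>I. \<Sum>j\<in>I. K i j * a i * cnj (a j)) \<in> \<real>\<^sub>\<ge>\<^sub>0"
proof (cases "I = {}")
  case False
  obtain h where h: "bij_betw h {..<card I} I"
    using ex_bij_betw_nat_finite[OF assms(1)] by (auto simp: atLeast0LessThan)
  have "card I \<ge> 1" using False assms(1) by (simp add: Suc_le_eq card_gt_0_iff)
  moreover have "\<forall>k<card I. h k \<in> I" using h by (auto dest: bij_betwE)
  ultimately have "psd_matrix (card I) (\<lambda>k l. K (h k) (h l))" by (rule psd)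
  hence "(\<Sum>k<card I. \<Sum>l<card I. K (h k) (h l) * a (h k) * cnj (a (h l))) \<in> \<real>\<^sub>\<ge>\<^sub>0"
    unfolding psd_matrix_def by (elim allE[of _ "\<lambda>k. a (h k)"])
  also have "(\<Sum>k<card I. \<Sum>l<card I. K (h k) (h l) * a (h k) * cnj (a (h l))) =
      (\<Sum>k<card I. \<Sum>j\<in>I. K (h k) j * a (h k) * cnj (a j))"
    by (intro sum.cong refl sum.reindex_bij_betw[OF h])
  also have "\<dots> = (\<Sum>i\<in>I. \<Sum>j\<in>I. K i j * a i * cnj (a j))"
    by (rule sum.reindex_bij_betw[OF h])
  finally show ?thesis .
qed simp

section \<open>Positive definite functions on a group\<close>

text \<open>The part of \<open>pos_def\<close> that survives pointwise limits; the continuity of the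
  limit functions is obtained by a separate argument.\<close>

definition pos_def_fun :: "('a, 'b) monoid_scheme \<Rightarrow> ('a \<Rightarrow> complex) \<Rightarrow> bool" where
  "pos_def_fun G \<phi> \<longleftrightarrow> (\<forall>n\<ge>1. \<forall>u. (\<forall>k<n. u k \<in> carrier G) \<longrightarrow>
     psd_matrix n (\<lambda>k l. \<phi> (inv\<^bsub>G\<^esub> u k \<otimes>\<^bsub>G\<^esub> u l)))"

lemma pos_def_iff: "\<phi> \<in> pos_def G T \<longleftrightarrow> continuous_map T euclidean \<phi> \<and> pos_def_fun G \<phi>"
  by (simp add: pos_def_def pos_def_fun_def)

lemma pos_def_fun_sum:
  "(\<And>i. i \<in> I \<Longrightarrow> pos_def_fun G (\<phi> i)) \<Longrightarrow> pos_def_fun G (\<lambda>u. \<Sum>i\<in>I. \<phi> i u)"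
  by (auto simp: pos_def_fun_def intro!: psd_matrix_sum)

lemma pos_def_fun_limit:
  fixes G :: "('a, 'b) monoid_scheme" (structure)
  assumes "group G" and "\<And>N. pos_def_fun G (\<phi> N)" and "\<And>u. u \<in> carrier G \<Longrightarrow> (\<lambda>N. \<phi> N u) \<longlonglongrightarrow> \<psi> u"
  shows "pos_def_fun G \<psi>"
  unfolding pos_def_fun_def
proof (intro allI impI)
  interpret group G by fact
  fix n u assume n: "n \<ge> (1::nat)" and u: "\<forall>k<n. u k \<in> carrier G"
  show "psd_matrix n (\<lambda>k l. \<psi> (inv u k \<otimes> u l))"
    by (rule psd_matrix_limit[of n "\<lambda>N k l. \<phi> N (inv u k \<otimes> u l)"])
       (use assms n u in \<open>auto simp: pos_def_fun_def\<close>)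
qed

lemma pos_def_fun_one:
  fixes G :: "('a, 'b) monoid_scheme" (structure)
  assumes "group G" and "pos_def_fun G \<phi>"
  shows "\<phi> \<one> \<in> \<real>\<^sub>\<ge>\<^sub>0"
proof -
  interpret group G by fact
  have "psd_matrix 1 (\<lambda>k l. \<phi> (inv \<one> \<otimes> \<one>))"
    using assms(2)[unfolded pos_def_fun_def, rule_format, of 1 "\<lambda>_. \<one>"] by simp
  from this[unfolded psd_matrix_def, rule_format, of "\<lambda>_. 1"] show ?thesis by simp
qed

text \<open>Test the two points \<open>\<one>\<close> and \<open>u\<close> with weights 1 and
  \<open>b\<close>. The values \<open>b = 1\<close> and \<open>b = \<i>\<close> force hermitian
  symmetry; the unimodular \<open>b\<close> that turns \<open>\<phi> u\<close> into minus its
  modulus gives the bound.\<close>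

lemma pos_def_fun_norm_le:
  fixes G :: "('a, 'b) monoid_scheme" (structure)
  assumes "group G" and "pos_def_fun G \<phi>" and u: "u \<in> carrier G"
  shows "norm (\<phi> u) \<le> Re (\<phi> \<one>)"
proof -
  interpret group G by fact
  have one: "\<phi> \<one> = of_real (Re (\<phi> \<one>))" "Re (\<phi> \<one>) \<ge> 0"
    using pos_def_fun_one[OF assms(1,2)] by (auto elim!: nonneg_Reals_cases)
  have q: "\<phi> \<one> + \<phi> u * cnj b + (\<phi> (inv u) * b + \<phi> \<one> * b * cnj b) \<in> \<real>\<^sub>\<ge>\<^sub>0" for b
  proof -
    have "psd_matrix 2 (\<lambda>k l. \<phi> (inv (if k = 0 then \<one> else u) \<otimes> (if l = 0 then \<one> else u)))"
      using assms(2)[unfolded pos_def_fun_def, rule_format, of 2 "\<lambda>k. if k = 0 then \<one> else u"] u by simp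
    from this[unfolded psd_matrix_def, rule_format, of "\<lambda>k. if k = 0 then 1 else b"] u
    show ?thesis by (simp add: numeral_2_eq_2)
  qed
  have im: "Im z = 0" "Re z \<ge> 0" if "z \<in> \<real>\<^sub>\<ge>\<^sub>0" for z :: complex
    using that by (auto elim!: nonneg_Reals_cases)
  have "\<phi> (inv u) = cnj (\<phi> u)"
    using im(1)[OF q[of 1]] im(1)[OF q[of \<i>]] im(1)[OF pos_def_fun_one[OF assms(1,2)]]
    by (simp add: complex_eq_iff)
  show ?thesis
  proof (cases "\<phi> u = 0")
    case False
    define b where "b = - \<phi> u / of_real (norm (\<phi> u))"
    have b: "b * cnj b = 1" "\<phi> u * cnj b = - of_real (norm (\<phi> u))"
      using False by (auto simp: b_def complex_norm_square[symmetric] power2_eq_square divide_simps)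
    moreover have "cnj (\<phi> u) * b = cnj (\<phi> u * cnj b)" by simp
    ultimately have eq: "\<phi> \<one> + \<phi> u * cnj b + (\<phi> (inv u) * b + \<phi> \<one> * b * cnj b) =
        2 * \<phi> \<one> - 2 * of_real (norm (\<phi> u))"
      using \<open>\<phi> (inv u) = cnj (\<phi> u)\<close> by (simp add: mult.assoc)
    show ?thesis using im(2)[OF q[of b, unfolded eq]] by simp
  qed (use one in auto)
qed

section \<open>Walsh coefficients and Bernstein polynomials\<close>

text \<open>A vertex of the cube \<open>{-1, 1}\<^sup>N\<close> is encoded by the set of its negative coordinates, so that
  the coordinatewise product becomes the symmetric difference.\<close>

definition walsh :: "nat set \<Rightarrow> nat set \<Rightarrow> real" where
  "walsh A S = (\<Prod>i\<in>A. if i \<in> S then - 1 else 1)"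

text \<open>This makes \<open>walsh A\<close> a character of the cube group: the sign of an index in
  the symmetric difference is the product of its two signs.\<close>

lemma walsh_sym_diff: "walsh A (sym_diff S R) = walsh A S * walsh A R"
  unfolding walsh_def prod.distrib[symmetric] by (intro prod.cong) auto

text \<open>The Fourier coefficient, at the character \<open>walsh A\<close>, of the function on the
  cube that sends a vertex to the value of \<open>f\<close> at the mean of its signs.\<close>

definition walsh_coeff :: "nat \<Rightarrow> (real \<times> 'a \<Rightarrow> complex) \<Rightarrow> nat set \<Rightarrow> 'a \<Rightarrow> complex" where
  "walsh_coeff N f A u =
     (\<Sum>S\<in>Pow {..<N}. of_real (walsh A S) * f (1 - 2 * real (card S) / real N, u)) / 2 ^ N"

definition cube_coeff :: "nat \<Rightarrow> (real \<times> 'a \<Rightarrow> complex) \<Rightarrow> nat \<Rightarrow> 'a \<Rightarrow> complex" where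
  "cube_coeff N f j u = (\<Sum>A\<in>{A. A \<subseteq> {..<N} \<and> card A = j}. walsh_coeff N f A u)"

lemma cube_coeff_eq_0:
  assumes "j > N"
  shows "cube_coeff N f j u = 0"
proof -
  have "card A \<noteq> j" if "A \<subseteq> {..<N}" for A
    using card_mono[OF finite_lessThan that] assms by simp
  hence "{A. A \<subseteq> {..<N} \<and> card A = j} = {}" by blast
  thus ?thesis by (simp only: cube_coeff_def sum.empty)
qed

lemma sum_Pow_card:
  fixes h :: "nat \<Rightarrow> 'b :: semiring_1"
  shows "(\<Sum>S\<in>Pow {..<N}. h (card S)) = (\<Sum>k\<le>N. of_nat (N choose k) * h k)"
proof -
  have "(\<Sum>S\<in>Pow {..<N}. h (card S)) =
      (\<Sum>k\<le>N. \<Sum>S\<in>{S. S \<in> Pow {..<N} \<and> card S = k}. h (card S))"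
    by (rule sum.group[symmetric]) (auto dest: card_mono[of "{..<N}", rotated])
  also have "\<dots> = (\<Sum>k\<le>N. of_nat (N choose k) * h k)"
    by (intro sum.cong refl) (simp add: n_subsets)
  finally show ?thesis .
qed

text \<open>The left-hand side is the \<open>N\<close>-th Bernstein polynomial of \<open>f(\<cdot>, u)\<close> on \<open>[-1, 1]\<close>. It is the
  mean of \<open>f(z, u)\<close> where \<open>z\<close> is the average of \<open>N\<close> independent signs of expectation \<open>x\<close>; this
  gives \<open>S\<close>, the set of negative signs, the density \<open>\<Prod>\<^sub>i (1 + x s\<^sub>i) / 2\<close>, whose expansion is
  the right-hand side.\<close>

lemma Bernstein_eq_cube_coeff:
  "(\<Sum>k\<le>N. f (1 - 2 * (real k / real N), u) * of_real (Bernstein N k ((1 - x) / 2))) =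
     (\<Sum>j\<le>N. cube_coeff N f j u * of_real x ^ j)"
proof -
  let ?y = "(1 - x) / 2"
  define F where "F = (\<lambda>k. f (1 - 2 * real k / real N, u))"
  have weight: "?y ^ card S * (1 - ?y) ^ (N - card S) = (\<Sum>A\<in>Pow {..<N}. x ^ card A * walsh A S) / 2 ^ N"
    if S: "S \<subseteq> {..<N}" for S
  proof -
    have "?y ^ card S * (1 - ?y) ^ (N - card S) = (\<Prod>i\<in>S. ?y) * (\<Prod>i\<in>{..<N} - S. 1 - ?y)"
      using S by (simp add: card_Diff_subset finite_subset)
    also have "\<dots> = (\<Prod>i\<in>S. if i \<in> S then ?y else 1 - ?y) * (\<Prod>i\<in>{..<N} - S. if i \<in> S then ?y else 1 - ?y)"
      by (intro arg_cong2[where f = "(*)"] prod.cong) auto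
    also have "\<dots> = (\<Prod>i<N. if i \<in> S then ?y else 1 - ?y)"
      by (subst prod.subset_diff[OF S]) (auto simp: mult.commute)
    also have "\<dots> = (\<Prod>i<N. (x * (if i \<in> S then - 1 else 1) + 1) / 2)"
      by (intro prod.cong) (auto simp: field_simps)
    also have "\<dots> = (\<Prod>i<N. x * (if i \<in> S then - 1 else 1) + 1) / 2 ^ N"
      by (simp add: prod_dividef)
    also have "(\<Prod>i<N. x * (if i \<in> S then - 1 else 1) + 1) = (\<Sum>A\<in>Pow {..<N}. x ^ card A * walsh A S)"
      by (subst prod_add) (simp_all add: prod.distrib walsh_def)
    finally show ?thesis .
  qed
  have "(\<Sum>k\<le>N. f (1 - 2 * (real k / real N), u) * of_real (Bernstein N k ?y)) =
      (\<Sum>k\<le>N. of_nat (N choose k) * (of_real (?y ^ k * (1 - ?y) ^ (N - k)) * F k))"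
    by (intro sum.cong refl) (simp add: Bernstein_def F_def)
  also have "\<dots> = (\<Sum>S\<in>Pow {..<N}. of_real (?y ^ card S * (1 - ?y) ^ (N - card S)) * F (card S))"
    by (rule sum_Pow_card[symmetric])
  also have "\<dots> = (\<Sum>S\<in>Pow {..<N}. \<Sum>A\<in>Pow {..<N}.
      of_real (x ^ card A) * (of_real (walsh A S) * F (card S) / 2 ^ N))"
  proof (intro sum.cong refl)
    fix S assume "S \<in> Pow {..<N}"
    hence "S \<subseteq> {..<N}" by simp
    from weight[OF this]
    show "complex_of_real (?y ^ card S * (1 - ?y) ^ (N - card S)) * F (card S) =
        (\<Sum>A\<in>Pow {..<N}. of_real (x ^ card A) * (of_real (walsh A S) * F (card S) / 2 ^ N))"
      by (simp only: of_real_divide of_real_sum sum_distrib_right sum_divide_distrib) (simp add: mult_ac)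
  qed
  also have "\<dots> = (\<Sum>A\<in>Pow {..<N}. of_real (x ^ card A) * walsh_coeff N f A u)"
    by (subst sum.swap) (simp add: walsh_coeff_def F_def sum_distrib_left sum_divide_distrib)
  also have "\<dots> = (\<Sum>j\<le>N. \<Sum>A\<in>{A. A \<in> Pow {..<N} \<and> card A = j}. of_real (x ^ card A) * walsh_coeff N f A u)"
    by (rule sum.group[symmetric]) (auto dest: card_mono[of "{..<N}", rotated])
  also have "\<dots> = (\<Sum>j\<le>N. cube_coeff N f j u * of_real x ^ j)"
    by (intro sum.cong refl) (simp add: cube_coeff_def sum_distrib_left mult.commute)
  finally show ?thesis .
qed

text \<open>Weierstrass approximation for real functions, applied to the real and imaginary
  parts.\<close>

lemma Bernstein_tendsto:
  fixes g :: "real \<Rightarrow> complex"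
  assumes "continuous_on {0..1} g" and y: "y \<in> {0..1}"
  shows "(\<lambda>N. \<Sum>k\<le>N. g (real k / real N) * of_real (Bernstein N k y)) \<longlonglongrightarrow> g y"
proof -
  have real: "(\<lambda>N. \<Sum>k\<le>N. h (real k / real N) * Bernstein N k y) \<longlonglongrightarrow> h y"
    if h: "continuous_on {0..1} h" for h :: "real \<Rightarrow> real"
  proof (rule LIMSEQ_I)
    fix e :: real assume "e > 0"
    from Bernstein_Weierstrass[OF h this] y
    show "\<exists>N0. \<forall>N\<ge>N0. norm ((\<Sum>k\<le>N. h (real k / real N) * Bernstein N k y) - h y) < e"
      by (auto simp: abs_minus_commute)
  qed
  have "(\<lambda>N. \<Sum>k\<le>N. Re (g (real k / real N)) * Bernstein N k y) \<longlonglongrightarrow> Re (g y)"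
    "(\<lambda>N. \<Sum>k\<le>N. Im (g (real k / real N)) * Bernstein N k y) \<longlonglongrightarrow> Im (g y)"
    by (rule real; intro continuous_intros assms)+
  thus ?thesis by (simp add: tendsto_complex_iff)
qed

section \<open>The cube inside the sphere\<close>

lemma sum_signs:
  assumes "S \<subseteq> {..<N}"
  shows "(\<Sum>i<N. if i \<in> S then - 1 else 1 :: real) = real N - 2 * real (card S)"
proof -
  have fin: "finite S" using assms finite_subset by blast
  have "(\<Sum>i<N. if i \<in> S then - 1 else 1 :: real) = (\<Sum>i<N. 1 - 2 * (if i \<in> S then 1 else 0))"
    by (intro sum.cong) auto
  also have "\<dots> = real N - 2 * (\<Sum>i<N. if i \<in> S then 1 else 0)"
    by (simp only: sum_subtractf sum_distrib_left[symmetric]) simp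
  also have "(\<Sum>i<N. if i \<in> S then 1 else 0 :: real) = real (card S)"
    using assms fin by (simp add: sum.If_cases Int_absorb1)
  finally show ?thesis .
qed

text \<open>A vertex scaled to length 1. Its \<open>N\<close> coordinates put it on the sphere of
  dimension \<open>N - 1\<close>, which explains the index \<open>N - 1\<close> below.\<close>

definition cube_vector :: "nat \<Rightarrow> nat set \<Rightarrow> nat \<Rightarrow> real" where
  "cube_vector N S i = (if i < N then (if i \<in> S then - 1 else 1) / sqrt (real N) else 0)"

text \<open>The product of two signs is -1 exactly on the symmetric difference, so the inner product
  depends on that set alone.\<close>

lemma cube_vector_inner:
  assumes "S \<subseteq> {..<N}" "R \<subseteq> {..<N}" "N > 0"
  shows "(\<Sum>i\<le>N - 1. cube_vector N S i * cube_vector N R i) = 1 - 2 * real (card (sym_diff S R)) / real N"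
proof -
  have "(\<Sum>i\<le>N - 1. cube_vector N S i * cube_vector N R i) =
      (\<Sum>i<N. (if i \<in> sym_diff S R then - 1 else 1) / real N)"
    using assms(3) by (intro sum.cong) (auto simp: cube_vector_def)
  also have "\<dots> = (real N - 2 * real (card (sym_diff S R))) / real N"
    using assms(1,2) by (subst sum_divide_distrib[symmetric], subst sum_signs) auto
  finally show ?thesis using assms(3) by (simp add: diff_divide_distrib)
qed

lemma cube_vector_in_nsphere:
  assumes "S \<subseteq> {..<N}" "N > 0"
  shows "cube_vector N S \<in> topspace (nsphere (N - 1))"
  using cube_vector_inner[OF assms(1,1,2)] assms(2)
  by (auto simp: nsphere power2_eq_square cube_vector_def)

text \<open>Test \<open>f\<close> at all pairs of a vertex \<open>S\<close> and a group element
  \<open>u k\<close>, with weight \<open>walsh A S * a k\<close>. The kernel and the product of the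
  characters depend on \<open>S\<close> and \<open>R\<close> only through their symmetric
  difference, so the double sum over the cube collapses to a Fourier coefficient.\<close>

lemma walsh_coeff_pos_def_fun:
  fixes G :: "('a, 'b) monoid_scheme" (structure)
  assumes f: "f \<in> pos_def_sphere (N - 1) G T" and N: "N > 0"
  shows "pos_def_fun G (walsh_coeff N f A)"
  unfolding pos_def_fun_def
proof (intro allI impI)
  fix n and u :: "nat \<Rightarrow> 'a" assume n: "n \<ge> 1" and u: "\<forall>k<n. u k \<in> carrier G"
  let ?P = "Pow {..<N}" and ?f = "\<lambda>S k l. f (1 - 2 * real (card S) / real N, inv u k \<otimes> u l)"
  show "psd_matrix n (\<lambda>k l. walsh_coeff N f A (inv u k \<otimes> u l))"
    unfolding psd_matrix_def
  proof
    fix a :: "nat \<Rightarrow> complex"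
    define K where "K = (\<lambda>p q. f (\<Sum>i\<le>N - 1. cube_vector N (fst p) i * cube_vector N (fst q) i,
        inv u (snd p) \<otimes> u (snd q)))"
    define b where "b = (\<lambda>p. of_real (walsh A (fst p)) * a (snd p))"
    have "(\<Sum>p\<in>?P \<times> {..<n}. \<Sum>q\<in>?P \<times> {..<n}. K p q * b p * cnj (b q)) \<in> \<real>\<^sub>\<ge>\<^sub>0"
    proof (rule psd_matrix_family)
      fix m :: nat and g assume m: "m \<ge> 1" and g: "\<forall>k<m. g k \<in> ?P \<times> {..<n}"
      have g': "fst (g k) \<in> ?P" "snd (g k) < n" if "k < m" for k
        using g[rule_format, OF that] by (auto simp: mem_Times_iff)
      have pts: "\<forall>k<m. cube_vector N (fst (g k)) \<in> topspace (nsphere (N - 1)) \<and> u (snd (g k)) \<in> carrier G"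
        using g' u cube_vector_in_nsphere[OF _ N] by simp
      have "\<forall>n\<ge>1. \<forall>\<xi> u. (\<forall>k<n. \<xi> k \<in> topspace (nsphere (N - 1)) \<and> u k \<in> carrier G) \<longrightarrow>
          psd_matrix n (\<lambda>k l. f (\<Sum>i\<le>N - 1. \<xi> k i * \<xi> l i, inv u k \<otimes> u l))"
        by (rule conjunct2[OF f[unfolded pos_def_sphere_def mem_Collect_eq]])
      from this[rule_format, OF m, of "\<lambda>k. cube_vector N (fst (g k))" "\<lambda>k. u (snd (g k))"] pts
      show "psd_matrix m (\<lambda>k l. K (g k) (g l))" by (simp only: K_def)
    qed simp
    also have "(\<Sum>p\<in>?P \<times> {..<n}. \<Sum>q\<in>?P \<times> {..<n}. K p q * b p * cnj (b q)) =
        (\<Sum>S\<in>?P. \<Sum>k<n. \<Sum>R\<in>?P. \<Sum>l<n. K (S, k) (R, l) * b (S, k) * cnj (b (R, l)))"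
      by (simp add: sum.cartesian_product')
    also have "\<dots> = (\<Sum>S\<in>?P. \<Sum>k<n. \<Sum>R\<in>?P. \<Sum>l<n.
        of_real (walsh A (sym_diff S R)) * ?f (sym_diff S R) k l * a k * cnj (a l))"
      using N by (intro sum.cong refl) (simp add: K_def b_def cube_vector_inner[unfolded One_nat_def] walsh_sym_diff mult_ac)
    also have "\<dots> = (\<Sum>S\<in>?P. \<Sum>k<n. \<Sum>R\<in>?P. \<Sum>l<n. of_real (walsh A R) * ?f R k l * a k * cnj (a l))"
    \<comment> \<open>Translation by \<open>S\<close> is an involution of the cube, so
      \<open>sym_diff S R\<close> may be renamed \<open>R\<close>.\<close>
    proof (rule sum.cong[OF refl], rule sum.cong[OF refl])
      fix S k assume "S \<in> ?P"
      hence "bij_betw (sym_diff S) ?P ?P"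
        by (intro bij_betw_byWitness[where f' = "sym_diff S"]) auto
      from sum.reindex_bij_betw[OF this, of "\<lambda>R. \<Sum>l<n. of_real (walsh A R) * ?f R k l * a k * cnj (a l)"]
      show "(\<Sum>R\<in>?P. \<Sum>l<n. of_real (walsh A (sym_diff S R)) * ?f (sym_diff S R) k l * a k * cnj (a l)) =
          (\<Sum>R\<in>?P. \<Sum>l<n. of_real (walsh A R) * ?f R k l * a k * cnj (a l))" .
    qed
    also have "\<dots> = 2 ^ N * (\<Sum>k<n. \<Sum>R\<in>?P. \<Sum>l<n. of_real (walsh A R) * ?f R k l * a k * cnj (a l))"
      by (simp add: card_Pow)
    also have "(\<Sum>k<n. \<Sum>R\<in>?P. \<Sum>l<n. of_real (walsh A R) * ?f R k l * a k * cnj (a l)) =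
        (\<Sum>k<n. \<Sum>l<n. 2 ^ N * (walsh_coeff N f A (inv u k \<otimes> u l) * a k * cnj (a l)))"
      by (intro sum.cong refl, subst sum.swap) (simp add: walsh_coeff_def sum_distrib_right)
    also have "\<dots> = 2 ^ N * (\<Sum>k<n. \<Sum>l<n. walsh_coeff N f A (inv u k \<otimes> u l) * a k * cnj (a l))"
      by (simp add: sum_distrib_left)
    \<comment> \<open>One factor \<open>2 ^ N\<close> counts the now idle \<open>S\<close>, the
      other clears the denominator of \<open>walsh_coeff\<close>.\<close>
    finally have "of_real (1 / (2 ^ N * 2 ^ N)) * (2 ^ N * (2 ^ N *
        (\<Sum>k<n. \<Sum>l<n. walsh_coeff N f A (inv u k \<otimes> u l) * a k * cnj (a l)))) \<in> \<real>\<^sub>\<ge>\<^sub>0"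
      by (rule nonneg_Reals_mult_I[rotated]) simp
    thus "(\<Sum>k<n. \<Sum>l<n. walsh_coeff N f A (inv u k \<otimes> u l) * a k * cnj (a l)) \<in> \<real>\<^sub>\<ge>\<^sub>0" by simp
  qed
qed

lemma cube_coeff_pos_def_fun:
  "f \<in> pos_def_sphere (N - 1) G T \<Longrightarrow> N > 0 \<Longrightarrow> pos_def_fun G (cube_coeff N f j)"
  unfolding cube_coeff_def by (intro pos_def_fun_sum walsh_coeff_pos_def_fun)

section \<open>Power series expansion\<close>

lemma continuous_slice_sphere:
  assumes "continuous_map (prod_topology (top_of_set {-1..1}) T) euclidean f" and "u \<in> topspace T"
  shows "continuous_on {-1..1} (\<lambda>x. f (x, u))"
proof -
  have "continuous_map (top_of_set {-1..1}) (prod_topology (top_of_set {-1..1}) T) (\<lambda>x. (x, u))"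
    using assms(2) by (auto simp: continuous_map_paired)
  from continuous_map_compose[OF this assms(1)] show ?thesis by (simp add: o_def)
qed

lemma continuous_slice_group:
  assumes "continuous_map (prod_topology (top_of_set {-1..1}) T) euclidean f" and "x \<in> {-1..1}"
  shows "continuous_map T euclidean (\<lambda>u. f (x, u))"
proof -
  have "continuous_map T (prod_topology (top_of_set {-1..1}) T) (\<lambda>u. (x, u))"
    using assms(2) by (auto simp: continuous_map_paired)
  from continuous_map_compose[OF this assms(1)] show ?thesis by (simp add: o_def)
qed

text \<open>The expansion in the variable \<open>x = cos \<theta>\<close>, together with the
  summable majorant \<open>Re (\<phi> n \<one>)\<close> that controls every later interchange of
  limits.\<close>

lemma schoenberg_expansionD:
  fixes G :: "('a, 'b) monoid_scheme" (structure)
  assumes G: "group G" and exp: "schoenberg_expansion G T f \<phi>"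
  shows "pos_def_fun G (\<phi> n)"
    and "u \<in> carrier G \<Longrightarrow> norm (\<phi> n u) \<le> Re (\<phi> n \<one>)"
    and "summable (\<lambda>n. Re (\<phi> n \<one>))"
    and "x \<in> {-1..1} \<Longrightarrow> u \<in> carrier G \<Longrightarrow> (\<lambda>n. \<phi> n u * of_real (x ^ n)) sums f (x, u)"
proof -
  show pd: "pos_def_fun G (\<phi> n)" for n
    using exp by (simp add: schoenberg_expansion_def pos_def_iff)
  show "u \<in> carrier G \<Longrightarrow> norm (\<phi> n u) \<le> Re (\<phi> n \<one>)"
    by (rule pos_def_fun_norm_le[OF G pd])
  show "summable (\<lambda>n. Re (\<phi> n \<one>))"
    using exp by (auto simp: schoenberg_expansion_def intro: summable_Re)
  assume x: "x \<in> {-1..1}" and u: "u \<in> carrier G"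
  have "\<forall>\<theta>\<in>{0..pi}. \<forall>u\<in>carrier G. (\<lambda>n. \<phi> n u * of_real (cos \<theta> ^ n)) sums f (cos \<theta>, u)"
    using exp by (simp add: schoenberg_expansion_def)
  from this[rule_format, of "arccos x" u] x u
  show "(\<lambda>n. \<phi> n u * of_real (x ^ n)) sums f (x, u)" by (simp add: arccos_bounded)
qed

section \<open>From the expansion to positive definiteness and uniform convergence\<close>

text \<open>Each partial sum is positive semidefinite by \<open>psd_matrix_mult_gram_power\<close>,
  and this passes to the limit.\<close>

lemma schoenberg_expansion_imp_pos_def_sphere:
  fixes G :: "('a, 'b) monoid_scheme" (structure)
  assumes G: "group G"
    and cont: "continuous_map (prod_topology (top_of_set {-1..1}) T) euclidean f"
    and exp: "schoenberg_expansion G T f \<phi>"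
  shows "f \<in> pos_def_sphere d G T"
  unfolding pos_def_sphere_def mem_Collect_eq
proof (intro conjI allI impI cont)
  interpret group G by fact
  fix n :: nat and \<xi> :: "nat \<Rightarrow> nat \<Rightarrow> real" and u :: "nat \<Rightarrow> 'a"
  assume n: "n \<ge> 1" and pts: "\<forall>k<n. \<xi> k \<in> topspace (nsphere d) \<and> u k \<in> carrier G"
  let ?x = "\<lambda>k l. \<Sum>i\<le>d. \<xi> k i * \<xi> l i"
  show "psd_matrix n (\<lambda>k l. f (?x k l, inv u k \<otimes> u l))"
  proof (rule psd_matrix_limit)
    show "psd_matrix n (\<lambda>k l. \<Sum>m<N. \<phi> m (inv u k \<otimes> u l) * of_real (?x k l ^ m))" for N
      using schoenberg_expansionD(1)[OF G exp] n pts
      by (intro psd_matrix_sum psd_matrix_mult_gram_power) (simp add: pos_def_fun_def)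
    fix k l assume kl: "k < n" "l < n"
    \<comment> \<open>Inner products of unit vectors stay in the interval where the expansion is
      assumed.\<close>
    have "(?x k l)\<^sup>2 \<le> (\<Sum>i\<le>d. (\<xi> k i)\<^sup>2) * (\<Sum>i\<le>d. (\<xi> l i)\<^sup>2)" by (rule Cauchy_Schwarz_ineq_sum)
    also have "\<dots> = 1" using pts kl by (simp add: nsphere)
    finally have "?x k l \<in> {-1..1}" by (simp add: abs_square_le_1 abs_le_iff)
    moreover have "inv u k \<otimes> u l \<in> carrier G" using pts kl by simp
    ultimately show "(\<lambda>N. \<Sum>m<N. \<phi> m (inv u k \<otimes> u l) * of_real (?x k l ^ m))
        \<longlonglongrightarrow> f (?x k l, inv u k \<otimes> u l)"
      using schoenberg_expansionD(4)[OF G exp] by (simp only: sums_def)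
  qed
qed

lemma schoenberg_expansion_uniform_limit:
  fixes G :: "('a, 'b) monoid_scheme" (structure)
  assumes G: "group G" and exp: "schoenberg_expansion G T f \<phi>"
  shows "uniform_limit ({-1..1} \<times> carrier G)
    (\<lambda>N (x, u). \<Sum>n<N. \<phi> n u * of_real (x ^ n)) f sequentially"
proof -
  have bound: "norm (\<phi> n (snd p) * of_real (fst p ^ n)) \<le> Re (\<phi> n \<one>)" if "p \<in> {-1..1} \<times> carrier G" for n p
  proof -
    have "\<bar>fst p\<bar> ^ n \<le> 1" using that by (intro power_le_one) auto
    hence "norm (\<phi> n (snd p)) * \<bar>fst p\<bar> ^ n \<le> Re (\<phi> n \<one>) * 1"
      using that schoenberg_expansionD(2)[OF G exp, of "snd p" n]
      by (intro mult_mono) (auto intro: order_trans[OF norm_ge_zero])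
    thus ?thesis by (simp add: norm_mult norm_power)
  qed
  have "uniform_limit ({-1..1} \<times> carrier G) (\<lambda>N p. \<Sum>n<N. \<phi> n (snd p) * of_real (fst p ^ n))
      (\<lambda>p. \<Sum>n. \<phi> n (snd p) * of_real (fst p ^ n)) sequentially"
    by (rule Weierstrass_m_test[OF bound schoenberg_expansionD(3)[OF G exp]])
  thus ?thesis
    by (rule uniform_limit_cong'[THEN iffD1, rotated 2])
       (use schoenberg_expansionD(4)[OF G exp] in \<open>auto simp: sums_iff\<close>)
qed

section \<open>From positive definiteness on all spheres to the expansion\<close>

text \<open>At \<open>x = 1\<close> the Bernstein polynomial is the plain sum of its coefficients
  and tends to \<open>f (1, \<one>)\<close>. At \<open>\<one>\<close> the coefficients are
  nonnegative, so every partial sum is eventually below the limit plus 1; positive definiteness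
  extends the bound to all of the group.\<close>

lemma cube_coeff_bound:
  fixes G :: "('a, 'b) monoid_scheme" (structure)
  assumes G: "group G" and T: "topspace T = carrier G" and f: "f \<in> pos_def_sphere_inf G T"
  defines "C \<equiv> Re (f (1, \<one>)) + 1"
  shows "\<forall>\<^sub>F N in sequentially. \<forall>J. (\<Sum>j\<in>J. Re (cube_coeff N f j \<one>)) \<le> C"
    and "\<forall>\<^sub>F N in sequentially. \<forall>j. \<forall>u\<in>carrier G. norm (cube_coeff N f j u) \<le> C"
proof -
  interpret group G by fact
  \<comment> \<open>\<open>N \<ge> 2\<close> because the spheres at hand start at dimension 1 and
    the cube lies in the sphere of dimension \<open>N - 1\<close>.\<close>
  have pd: "pos_def_fun G (cube_coeff N f j)" if "N \<ge> 2" for N j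
  proof -
    have "f \<in> pos_def_sphere (N - 1) G T" using f that by (auto simp: pos_def_sphere_inf_def)
    thus ?thesis using that by (intro cube_coeff_pos_def_fun) auto
  qed
  have cont: "continuous_map (prod_topology (top_of_set {-1..1}) T) euclidean f"
    using f by (auto simp: pos_def_sphere_inf_def pos_def_sphere_def)
  have "continuous_on {0..1} (\<lambda>y. f (1 - 2 * y, \<one>))"
    by (rule continuous_on_compose2[OF continuous_slice_sphere[OF cont, of \<one>]])
       (auto intro!: continuous_intros simp: T)
  from Bernstein_tendsto[OF this, of 0]
  have "(\<lambda>N. \<Sum>j\<le>N. cube_coeff N f j \<one>) \<longlonglongrightarrow> f (1, \<one>)"
    using Bernstein_eq_cube_coeff[where f = f and u = "\<one>" and x = 1] by simp
  hence "(\<lambda>N. Re (\<Sum>j\<le>N. cube_coeff N f j \<one>)) \<longlonglongrightarrow> Re (f (1, \<one>))" by (rule tendsto_Re)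
  hence "\<forall>\<^sub>F N in sequentially. Re (\<Sum>j\<le>N. cube_coeff N f j \<one>) < C"
    by (rule order_tendstoD) (simp add: C_def)
  hence sum: "\<forall>\<^sub>F N in sequentially. N \<ge> 2 \<and> (\<forall>J. (\<Sum>j\<in>J. Re (cube_coeff N f j \<one>)) \<le> C)"
    using eventually_ge_at_top[of 2]
  proof eventually_elim
    case (elim N)
    have nonneg: "Re (cube_coeff N f j \<one>) \<ge> 0" for j
      using pos_def_fun_one[OF G pd[OF elim(2), of j]] by (auto elim!: nonneg_Reals_cases)
    have "(\<Sum>j\<in>J. Re (cube_coeff N f j \<one>)) \<le> C" for J
    proof (cases "finite J")
      case True
      have "(\<Sum>j\<in>J. Re (cube_coeff N f j \<one>)) = (\<Sum>j\<in>J \<inter> {..N}. Re (cube_coeff N f j \<one>))"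
        using True by (intro sum.mono_neutral_right) (auto simp: cube_coeff_eq_0 not_le)
      also have "\<dots> \<le> (\<Sum>j\<le>N. Re (cube_coeff N f j \<one>))"
        using nonneg by (intro sum_mono2) auto
      finally show ?thesis using elim by simp
    next
      \<comment> \<open>A sum over an infinite set is 0 by convention, so only
        \<open>C \<ge> 0\<close> has to be shown.\<close>
      case False
      have "0 \<le> (\<Sum>j\<le>N. Re (cube_coeff N f j \<one>))" using nonneg by (intro sum_nonneg)
      thus ?thesis using False elim by simp
    qed
    thus ?case using elim by blast
  qed
  thus "\<forall>\<^sub>F N in sequentially. \<forall>J. (\<Sum>j\<in>J. Re (cube_coeff N f j \<one>)) \<le> C"
    by (rule eventually_mono) blast
  show "\<forall>\<^sub>F N in sequentially. \<forall>j. \<forall>u\<in>carrier G. norm (cube_coeff N f j u) \<le> C"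
    using sum
  proof eventually_elim
    case (elim N)
    have "norm (cube_coeff N f j u) \<le> C" if "u \<in> carrier G" for j u
      using pos_def_fun_norm_le[OF G pd that, of N j] elim
      by (metis (no_types, lifting) order_trans sum.empty sum.insert finite.emptyI empty_iff add.right_neutral)
    thus ?case by blast
  qed
qed

text \<open>The Bernstein polynomials written as infinite series, the form required by
  \<open>power_series_coeffs_tendsto_0\<close> and by Tannery's theorem.\<close>

lemma cube_coeff_series_tendsto:
  assumes f: "continuous_map (prod_topology (top_of_set {-1..1}) T) euclidean f"
    and u: "u \<in> topspace T" and x: "x \<in> {-1..1}"
  shows "(\<lambda>N. \<Sum>j. cube_coeff N f j u * of_real x ^ j) \<longlonglongrightarrow> f (x, u)"
proof -
  have "continuous_on {0..1} (\<lambda>y. f (1 - 2 * y, u))"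
    by (rule continuous_on_compose2[OF continuous_slice_sphere[OF f u]])
       (auto intro!: continuous_intros)
  from Bernstein_tendsto[OF this, of "(1 - x) / 2"] x
  have "(\<lambda>N. \<Sum>j\<le>N. cube_coeff N f j u * of_real x ^ j) \<longlonglongrightarrow> f (1 - 2 * ((1 - x) / 2), u)"
    unfolding Bernstein_eq_cube_coeff by simp
  hence "(\<lambda>N. \<Sum>j\<le>N. cube_coeff N f j u * of_real x ^ j) \<longlonglongrightarrow> f (x, u)"
    by (simp add: field_simps)
  moreover have "(\<Sum>j. cube_coeff N f j u * of_real x ^ j) = (\<Sum>j\<le>N. cube_coeff N f j u * of_real x ^ j)" for N
    by (rule suminf_finite) (auto simp: cube_coeff_eq_0 not_le)
  ultimately show ?thesis by simp
qed

text \<open>For two large indices both series are close to \<open>f (x, u)\<close>. Hence the series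
  of the differences tends to 0 along the product filter, so do its coefficients, and each
  coefficient sequence is Cauchy.\<close>

lemma cube_coeff_convergent:
  fixes G :: "('a, 'b) monoid_scheme" (structure)
  assumes G: "group G" and T: "topspace T = carrier G" and f: "f \<in> pos_def_sphere_inf G T" and u: "u \<in> carrier G"
  shows "convergent (\<lambda>N. cube_coeff N f j u)"
proof -
  have cont: "continuous_map (prod_topology (top_of_set {-1..1}) T) euclidean f"
    using f by (auto simp: pos_def_sphere_inf_def pos_def_sphere_def)
  define C where "C = Re (f (1, \<one>)) + 1"
  define c where "c = (\<lambda>j p. cube_coeff (fst p) f j u - cube_coeff (snd p) f j u)"
  have summ: "summable (\<lambda>j. cube_coeff N f j u * of_real x ^ j)" for N x
    by (rule summable_finite[of "{..N}"]) (auto simp: cube_coeff_eq_0 not_le)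
  have fst: "filterlim fst sequentially (sequentially \<times>\<^sub>F sequentially)"
    and snd: "filterlim snd sequentially (sequentially \<times>\<^sub>F sequentially)"
    by (auto intro: filterlim_fst filterlim_snd)
  have "(c j \<longlongrightarrow> 0) (sequentially \<times>\<^sub>F sequentially)"
  proof (rule power_series_coeffs_tendsto_0)
    have b: "\<forall>\<^sub>F N in sequentially. \<forall>j. norm (cube_coeff N f j u) \<le> C"
      using cube_coeff_bound(2)[OF G T f] by eventually_elim (use u in \<open>auto simp: C_def\<close>)
    show "\<forall>\<^sub>F p in sequentially \<times>\<^sub>F sequentially. \<forall>j. norm (c j p) \<le> C + C"
      using eventually_compose_filterlim[OF b fst] eventually_compose_filterlim[OF b snd]
    proof eventually_elim
      case (elim p)
      thus ?case unfolding c_def by (blast intro: norm_triangle_le_diff add_mono)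
    qed
    fix x :: real assume x: "0 < x" "x < 1"
    have lim: "(\<lambda>N. \<Sum>j. cube_coeff N f j u * of_real x ^ j) \<longlonglongrightarrow> f (x, u)"
      using x by (intro cube_coeff_series_tendsto[OF cont]) (auto simp: T u)
    have "((\<lambda>p. (\<Sum>j. cube_coeff (fst p) f j u * of_real x ^ j) -
        (\<Sum>j. cube_coeff (snd p) f j u * of_real x ^ j)) \<longlongrightarrow> f (x, u) - f (x, u))
        (sequentially \<times>\<^sub>F sequentially)"
      by (intro tendsto_diff filterlim_compose[OF lim fst] filterlim_compose[OF lim snd])
    thus "((\<lambda>p. \<Sum>j. c j p * of_real x ^ j) \<longlongrightarrow> 0) (sequentially \<times>\<^sub>F sequentially)"
      by (simp add: c_def left_diff_distrib suminf_diff[OF summ summ])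
  qed
  have "Cauchy (\<lambda>N. cube_coeff N f j u)"
  proof (rule metric_CauchyI)
    fix e :: real assume "e > 0"
    from tendstoD[OF \<open>(c j \<longlongrightarrow> 0) _\<close> this]
    show "\<exists>M. \<forall>m\<ge>M. \<forall>n\<ge>M. dist (cube_coeff m f j u) (cube_coeff n f j u) < e"
      by (auto simp: eventually_prod_sequentially c_def dist_norm norm_minus_commute)
  qed
  thus ?thesis by (rule Cauchy_convergent)
qed

text \<open>The limits of the cube coefficients inherit positive definiteness and the bound on their
  sum at \<open>\<one>\<close>. The expansion is first proved for \<open>\<bar>x\<bar> < 1\<close>,
  then extended to the endpoints, and only then used to show that the limits are continuous on the
  group.\<close>

lemma pos_def_sphere_inf_imp_schoenberg_expansion:
  fixes G :: "('a, 'b) monoid_scheme" (structure)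
  assumes G: "group G" and T: "topspace T = carrier G" and f: "f \<in> pos_def_sphere_inf G T"
  shows "\<exists>\<phi>. schoenberg_expansion G T f \<phi>"
proof -
  interpret group G by fact
  have cont: "continuous_map (prod_topology (top_of_set {-1..1}) T) euclidean f"
    using f by (auto simp: pos_def_sphere_inf_def pos_def_sphere_def)
  define C where "C = Re (f (1, \<one>)) + 1"
  define \<phi> where "\<phi> = (\<lambda>j u. lim (\<lambda>N. cube_coeff N f j u))"
  have lim: "(\<lambda>N. cube_coeff N f j u) \<longlonglongrightarrow> \<phi> j u" if "u \<in> carrier G" for j u
    using cube_coeff_convergent[OF G T f that] by (simp add: \<phi>_def convergent_LIMSEQ_iff)
  have pd: "pos_def_fun G (\<phi> j)" for j
  proof (rule pos_def_fun_limit[OF G])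
    \<comment> \<open>The shift by 2 keeps the dimension of the sphere at least 1.\<close>
    show "pos_def_fun G (cube_coeff (N + 2) f j)" for N
      using f by (intro cube_coeff_pos_def_fun) (auto simp: pos_def_sphere_inf_def)
    show "(\<lambda>N. cube_coeff (N + 2) f j u) \<longlonglongrightarrow> \<phi> j u" if "u \<in> carrier G" for u
      by (rule LIMSEQ_ignore_initial_segment[OF lim[OF that]])
  qed
  have norm_le: "norm (\<phi> j u) \<le> Re (\<phi> j \<one>)" if "u \<in> carrier G" for j u
    by (rule pos_def_fun_norm_le[OF G pd that])
  have nonneg: "Re (\<phi> j \<one>) \<ge> 0" and real: "\<phi> j \<one> = of_real (Re (\<phi> j \<one>))" for j
    using pos_def_fun_one[OF G pd, of j] by (auto elim!: nonneg_Reals_cases)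
  have le_C: "(\<Sum>j\<in>J. Re (\<phi> j \<one>)) \<le> C" for J
  proof (rule tendsto_upperbound)
    show "(\<lambda>N. \<Sum>j\<in>J. Re (cube_coeff N f j \<one>)) \<longlonglongrightarrow> (\<Sum>j\<in>J. Re (\<phi> j \<one>))"
      by (intro tendsto_sum tendsto_Re lim) simp
    show "\<forall>\<^sub>F N in sequentially. (\<Sum>j\<in>J. Re (cube_coeff N f j \<one>)) \<le> C"
      using cube_coeff_bound(1)[OF G T f] by eventually_elim (simp add: C_def)
  qed simp
  have summ: "summable (\<lambda>j. Re (\<phi> j \<one>))"
    by (rule summableI_nonneg_bounded[of _ C]) (use nonneg le_C in auto)
  have norm_le_C: "norm (\<phi> j u) \<le> C" if "u \<in> carrier G" for j u
    using norm_le[OF that, of j] le_C[of "{j}"] by simp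
  have term_le: "norm (\<phi> j u * of_real x ^ j) \<le> Re (\<phi> j \<one>)" if "u \<in> carrier G" "x \<in> {-1..1}" for j u x
  proof -
    have "norm (\<phi> j u) * \<bar>x\<bar> ^ j \<le> Re (\<phi> j \<one>) * 1"
      using that nonneg norm_le[OF that(1)] by (intro mult_mono power_le_one) auto
    thus ?thesis by (simp add: norm_mult norm_power)
  qed
  \<comment> \<open>Tannery's theorem with the geometric majorant
    \<open>C * \<bar>x\<bar> ^ j\<close>, which is summable only inside the interval.\<close>
  have interior: "(\<Sum>j. \<phi> j u * of_real x ^ j) = f (x, u)" if u: "u \<in> carrier G" and x: "x \<in> {-1<..<1}" for u x
  proof (rule LIMSEQ_unique)
    show "(\<lambda>N. \<Sum>j. cube_coeff N f j u * of_real x ^ j) \<longlonglongrightarrow> f (x, u)"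
      using x by (intro cube_coeff_series_tendsto[OF cont]) (auto simp: T u)
    have b: "\<forall>\<^sub>F N in sequentially. \<forall>j. norm (cube_coeff N f j u) \<le> C"
      using cube_coeff_bound(2)[OF G T f] by eventually_elim (use u in \<open>auto simp: C_def\<close>)
    have "\<forall>\<^sub>F (j, N) in sequentially \<times>\<^sub>F sequentially. norm (cube_coeff N f j u * of_real x ^ j) \<le> C * \<bar>x\<bar> ^ j"
      unfolding eventually_prod_filter
      by (intro exI[of _ "\<lambda>_. True"] exI conjI, simp, rule b)
         (auto simp: norm_mult norm_power intro!: mult_right_mono)
    moreover have "summable (\<lambda>j. C * \<bar>x\<bar> ^ j)"
      using x by (intro summable_mult summable_geometric) auto
    ultimately show "(\<lambda>N. \<Sum>j. cube_coeff N f j u * of_real x ^ j) \<longlonglongrightarrow> (\<Sum>j. \<phi> j u * of_real x ^ j)"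
      using tannerys_theorem[OF tendsto_mult_right[OF lim[OF u]]] by simp
  qed
  \<comment> \<open>The series is uniformly convergent, hence continuous, on the closed interval; it
    agrees with \<open>f\<close> inside and therefore also at the endpoints.\<close>
  have sums: "(\<lambda>j. \<phi> j u * of_real x ^ j) sums f (x, u)" if u: "u \<in> carrier G" and x: "x \<in> {-1..1}" for u x
  proof -
    have "uniform_limit {-1..1} (\<lambda>N x. \<Sum>j<N. \<phi> j u * of_real x ^ j) (\<lambda>x. \<Sum>j. \<phi> j u * of_real x ^ j) sequentially"
      by (rule Weierstrass_m_test[OF _ summ]) (use term_le u in auto)
    hence "continuous_on {-1..1} (\<lambda>x. \<Sum>j. \<phi> j u * of_real x ^ j)"
      by (rule uniform_limit_theorem[rotated]) (auto intro!: always_eventually continuous_intros)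
    hence "continuous_on (closure {-1<..<1}) (\<lambda>x. (\<Sum>j. \<phi> j u * of_real x ^ j) - f (x, u))"
      using continuous_slice_sphere[OF cont, of u] u by (auto intro!: continuous_intros simp: T)
    hence "(\<Sum>j. \<phi> j u * of_real x ^ j) - f (x, u) = 0"
      by (rule continuous_constant_on_closure) (use interior[OF u] x in auto)
    moreover have "summable (\<lambda>j. \<phi> j u * of_real x ^ j)"
      by (rule summable_comparison_test'[OF summ, of 0]) (use term_le u x in auto)
    ultimately show ?thesis by (simp add: sums_iff)
  qed
  have cont_\<phi>: "continuous_map T euclidean (\<phi> j)" for j
    unfolding continuous_map_atin
  proof
    fix u assume "u \<in> topspace T"
    hence u: "u \<in> carrier G" by (simp add: T)
    have carr: "\<forall>\<^sub>F v in atin T u. v \<in> carrier G"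
      unfolding eventually_atin using T by (metis DiffE openin_topspace)
    \<comment> \<open>These differences are the coefficients of \<open>f (x, v) - f (x, u)\<close>,
      which tends to 0 as \<open>v\<close> approaches \<open>u\<close> for each fixed
      \<open>x\<close>.\<close>
    have "((\<lambda>v. \<phi> j v - \<phi> j u) \<longlongrightarrow> 0) (atin T u)"
    proof (rule power_series_coeffs_tendsto_0[of "\<lambda>j v. \<phi> j v - \<phi> j u"])
      show "\<forall>\<^sub>F v in atin T u. \<forall>j. norm (\<phi> j v - \<phi> j u) \<le> C + C"
        using carr by eventually_elim (blast intro: norm_triangle_le_diff add_mono norm_le_C u)
      fix x :: real assume x: "0 < x" "x < 1"
      have "continuous_map T euclidean (\<lambda>v. f (x, v))"
        using x by (intro continuous_slice_group[OF cont]) auto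
      hence "((\<lambda>v. f (x, v)) \<longlongrightarrow> f (x, u)) (atin T u)"
        using u by (simp add: continuous_map_atin T)
      hence "((\<lambda>v. f (x, v) - f (x, u)) \<longlongrightarrow> f (x, u) - f (x, u)) (atin T u)"
        by (intro tendsto_diff tendsto_const)
      moreover have "\<forall>\<^sub>F v in atin T u. f (x, v) - f (x, u) = (\<Sum>j. (\<phi> j v - \<phi> j u) * of_real x ^ j)"
        using carr
      proof eventually_elim
        case (elim v)
        have "x \<in> {-1..1}" using x by simp
        from sums_diff[OF sums[OF elim this] sums[OF u this]] show ?case
          by (simp add: left_diff_distrib sums_iff)
      qed
      ultimately show "((\<lambda>v. \<Sum>j. (\<phi> j v - \<phi> j u) * of_real x ^ j) \<longlongrightarrow> 0) (atin T u)"
        by (simp add: Lim_transform_eventually)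
    qed
    thus "limitin euclidean (\<phi> j) (\<phi> j u) (atin T u)"
      by (simp add: LIM_zero_iff)
  qed
  have "summable (\<lambda>j. complex_of_real (Re (\<phi> j \<one>)))" using summ by (rule summable_of_real)
  hence "summable (\<lambda>j. \<phi> j \<one>)" using real by simp
  moreover have "cos \<theta> \<in> {-1..1}" for \<theta> :: real by simp
  ultimately show ?thesis
    unfolding schoenberg_expansion_def pos_def_iff using pd cont_\<phi> sums by (intro exI[of _ \<phi>]) auto
qed

section \<open>Gegenbauer polynomials\<close>

lemma powser_sums_0_imp_coeff_0:
  fixes a :: "nat \<Rightarrow> real"
  assumes "\<And>r. \<bar>r\<bar> < 1 \<Longrightarrow> (\<lambda>n. a n * r ^ n) sums 0"
  shows "a n = 0"
proof (induction n rule: less_induct)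
  case (less n)
  have "(\<lambda>k. a (k + n) * r ^ k) sums 0" if r: "r \<noteq> 0" "norm r < 1" for r
  proof -
    have "(\<lambda>k. a (k + n) * r ^ (k + n)) sums 0"
      using less assms[of r] r by (subst sums_iff_shift) simp
    from sums_mult[OF this, of "1 / r ^ n"] show ?thesis
      using r by (simp add: power_add)
  qed
  hence "((\<lambda>_::real. 0) \<longlongrightarrow> a (0 + n)) (at 0)"
    by (intro powser_limit_0_strong[of 1]) auto
  thus ?case by (simp add: tendsto_const_iff)
qed

lemma gegenbauer_0:
  assumes "\<bar>x\<bar> \<le> 1"
  shows "gegenbauer lam 0 x = 1"
proof -
  have "(\<lambda>n. gegenbauer lam n x * 0 ^ n) sums 1"
    using gegenbauer_sums[OF assms, of 0 lam] by simp
  thus ?thesis using powser_sums_zero[of "\<lambda>n. gegenbauer lam n x"] sums_unique2 by blast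
qed

text \<open>Both identities compare coefficients in \<open>(1 - 2xr + r\<^sup>2) g' = 2 \<lambda> (x - r) g\<close>, which the
  generating function \<open>g(r) = (1 - 2xr + r\<^sup>2) powr -\<lambda>\<close> satisfies.\<close>

lemma gegenbauer_recurrence:
  assumes x: "\<bar>x\<bar> \<le> 1"
  shows gegenbauer_1: "gegenbauer lam (Suc 0) x = 2 * lam * x"
    and gegenbauer_Suc_Suc: "(real n + 2) * gegenbauer lam (Suc (Suc n)) x =
      2 * (real n + 1 + lam) * x * gegenbauer lam (Suc n) x - (real n + 2 * lam) * gegenbauer lam n x"
proof -
  define a where "a = (\<lambda>n. gegenbauer lam n x)"
  \<comment> \<open>\<open>e n\<close> is the coefficient of \<open>r ^ n\<close> in the difference
    of the two sides of the differential equation; the case distinctions are the shifts by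
    \<open>r\<close> and \<open>r\<^sup>2\<close>.\<close>
  define e where "e = (\<lambda>n. diffs a n - 2 * lam * x * a n
      - (case n of 0 \<Rightarrow> 0 | Suc k \<Rightarrow> 2 * x * diffs a k - 2 * lam * a k)
      + (case n of 0 \<Rightarrow> 0 | Suc 0 \<Rightarrow> 0 | Suc (Suc k) \<Rightarrow> diffs a k))"
  have "(\<lambda>n. e n * r ^ n) sums 0" if r: "\<bar>r\<bar> < 1" for r
  proof -
    let ?q = "\<lambda>r. 1 - 2 * x * r + r\<^sup>2"
    have pos: "?q s > 0" if s: "\<bar>s\<bar> < 1" for s
    proof -
      have "x * s \<le> \<bar>x\<bar> * \<bar>s\<bar>" by (metis abs_ge_self abs_mult)
      also have "\<dots> \<le> 1 * \<bar>s\<bar>" using x by (intro mult_right_mono) auto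
      finally have "x * s \<le> 1 * \<bar>s\<bar>" .
      moreover have "(1 - \<bar>s\<bar>)\<^sup>2 > 0" using s by simp
      ultimately show ?thesis by (simp add: power2_eq_square algebra_simps)
    qed
    have sm: "(\<lambda>n. a n * s ^ n) sums (?q s powr (- lam))" if "\<bar>s\<bar> < 1" for s
      unfolding a_def by (rule gegenbauer_sums[OF x that])
    have smb: "summable (\<lambda>n. a n * s ^ n)" if "norm s < 1" for s
      using sm[of s] that sums_summable by auto
    have D1: "((\<lambda>z. \<Sum>n. a n * z ^ n) has_field_derivative (\<Sum>n. diffs a n * r ^ n)) (at r)"
      by (rule termdiffs_strong'[of 1]) (use smb r in auto)
    have D2: "((\<lambda>z. ?q z powr (- lam)) has_field_derivative
        - lam * ?q r powr (- lam - 1) * (2 * r - 2 * x)) (at r)"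
      using pos[OF r] by (auto intro!: derivative_eq_intros)
    \<comment> \<open>Near \<open>r\<close> the series equals the generating function, so both
      expressions for the derivative must agree.\<close>
    have D3: "((\<lambda>z. \<Sum>n. a n * z ^ n) has_field_derivative
        - lam * ?q r powr (- lam - 1) * (2 * r - 2 * x)) (at r)"
    proof (rule has_field_derivative_transform_within[OF D2])
      show "0 < 1 - \<bar>r\<bar>" using r by simp
      fix z assume "dist z r < 1 - \<bar>r\<bar>"
      hence "\<bar>z\<bar> < 1" by (auto simp: dist_real_def)
      from sums_unique[OF sm[OF this]] show "?q z powr (- lam) = (\<Sum>n. a n * z ^ n)" .
    qed simp
    define D where "D = (\<Sum>n. diffs a n * r ^ n)"
    define P where "P = ?q r powr (- lam)"
    have "D = - lam * ?q r powr (- lam - 1) * (2 * r - 2 * x)"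
      unfolding D_def by (rule DERIV_unique[OF D1 D3])
    moreover have "?q r * ?q r powr (- lam - 1) = P"
      using pos[OF r] by (simp add: P_def powr_diff)
    ultimately have ode: "?q r * D = 2 * lam * (x - r) * P" by algebra
    have sD: "(\<lambda>n. diffs a n * r ^ n) sums D"
      unfolding D_def using termdiff_converges[of r 1 a] smb r by auto
    have sP: "(\<lambda>n. a n * r ^ n) sums P" unfolding P_def by (rule sm[OF r])
    have s1: "(\<lambda>n. (diffs a n - 2 * lam * x * a n) * r ^ n) sums (D - 2 * lam * x * P)"
      using sums_diff[OF sD sums_mult[OF sP, of "2 * lam * x"]] by (simp add: algebra_simps)
    have "(\<lambda>n. (2 * x * diffs a n - 2 * lam * a n) * r ^ Suc n) sums (r * (2 * x * D - 2 * lam * P))"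
      using sums_mult[OF sums_diff[OF sums_mult[OF sD, of "2 * x"] sums_mult[OF sP, of "2 * lam"]], of r]
      by (simp add: algebra_simps)
    hence s2: "(\<lambda>n. (case n of 0 \<Rightarrow> 0 | Suc k \<Rightarrow> 2 * x * diffs a k - 2 * lam * a k) * r ^ n) sums
        (r * (2 * x * D - 2 * lam * P))"
      by - (rule sums_Suc_imp, simp_all)
    have "(\<lambda>n. diffs a n * r ^ Suc (Suc n)) sums (r\<^sup>2 * D)"
      using sums_mult[OF sD, of "r\<^sup>2"] by (simp add: algebra_simps power2_eq_square)
    hence s3: "(\<lambda>n. (case n of 0 \<Rightarrow> 0 | Suc 0 \<Rightarrow> 0 | Suc (Suc k) \<Rightarrow> diffs a k) * r ^ n) sums (r\<^sup>2 * D)"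
      by - (rule sums_Suc_imp, simp, rule sums_Suc_imp, simp_all)
    have "D - 2 * lam * x * P - r * (2 * x * D - 2 * lam * P) + r\<^sup>2 * D = 0"
      using ode by algebra
    with sums_add[OF sums_diff[OF s1 s2] s3] show ?thesis
      by (simp add: e_def algebra_simps)
  qed
  hence e0: "e n = 0" for n by (rule powser_sums_0_imp_coeff_0)
  show "gegenbauer lam (Suc 0) x = 2 * lam * x"
    using e0[of 0] gegenbauer_0[OF x, of lam] by (simp add: e_def diffs_def a_def)
  show "(real n + 2) * gegenbauer lam (Suc (Suc n)) x =
      2 * (real n + 1 + lam) * x * gegenbauer lam (Suc n) x - (real n + 2 * lam) * gegenbauer lam n x"
  proof (cases n)
    case 0
    thus ?thesis using e0[of "Suc 0"] by (simp add: e_def diffs_def a_def algebra_simps)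
  next
    case (Suc k)
    thus ?thesis using e0[of "Suc n"] by (simp add: e_def diffs_def a_def algebra_simps)
  qed
qed

text \<open>At \<open>x = 1\<close> the generating function is
  \<open>(1 - r) powr (- 2 * lam)\<close>, whose binomial coefficients these are; the proof checks
  them against the recurrence.\<close>

lemma gegenbauer_at_1: "gegenbauer lam n 1 = pochhammer (2 * lam) n / fact n"
proof (induction n rule: induct_nat_012)
  case (ge2 n)
  have "(real n + 2) * gegenbauer lam (Suc (Suc n)) 1 =
    2 * (real n + 1 + lam) * (pochhammer (2 * lam) (Suc n) / fact (Suc n))
      - (real n + 2 * lam) * (pochhammer (2 * lam) n / fact n)"
    using gegenbauer_Suc_Suc[of 1 n lam] ge2 by simp
  also have "\<dots> = (real n + 2) * (pochhammer (2 * lam) (Suc (Suc n)) / fact (Suc (Suc n)))"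
    by (simp add: pochhammer_rec' divide_simps del: of_nat_Suc) (simp add: algebra_simps)
  finally have "(real n + 2) * gegenbauer lam (Suc (Suc n)) 1 =
      (real n + 2) * (pochhammer (2 * lam) (Suc (Suc n)) / fact (Suc (Suc n)))" .
  moreover have "real n + 2 \<noteq> 0" by linarith
  ultimately show ?case using mult_left_cancel by blast
qed (simp_all add: gegenbauer_0 gegenbauer_1)

text \<open>The pointwise definition hides that these are polynomials in \<open>x\<close>; the
  recurrence recovers what is needed on the interval.\<close>

lemma continuous_on_gegenbauer: "continuous_on {-1..1} (gegenbauer lam n)"
proof (induction n rule: induct_nat_012)
  case 0
  have "continuous_on {-1..1::real} (\<lambda>x. 1 :: real)" by simp
  thus ?case by (rule continuous_on_eq) (auto simp: gegenbauer_0)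
next
  case 1
  have "continuous_on {-1..1::real} (\<lambda>x. 2 * lam * x)" by (intro continuous_intros)
  thus ?case by (rule continuous_on_eq) (auto simp: gegenbauer_1)
next
  case (ge2 n)
  have "continuous_on {-1..1} (\<lambda>x. (2 * (real n + 1 + lam) * x * gegenbauer lam (Suc n) x
      - (real n + 2 * lam) * gegenbauer lam n x) / (real n + 2))"
    using ge2 by (intro continuous_intros) auto
  thus ?case
  proof (rule continuous_on_eq)
    fix x :: real assume "x \<in> {-1..1}"
    hence "\<bar>x\<bar> \<le> 1" by auto
    from gegenbauer_Suc_Suc[OF this, of n lam]
    show "(2 * (real n + 1 + lam) * x * gegenbauer lam (Suc n) x
      - (real n + 2 * lam) * gegenbauer lam n x) / (real n + 2) = gegenbauer lam (Suc (Suc n)) x"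
      by (metis nonzero_mult_div_cancel_left of_nat_0_le_iff add_nonneg_pos zero_less_numeral less_irrefl)
  qed
qed

section \<open>Moments of the weight\<close>

text \<open>Integrate the derivatives of \<open>sqrt (1 - x\<^sup>2) ^ (k + 2)\<close> and of its
  product with \<open>x ^ (m + 1)\<close>; both functions vanish at the endpoints.\<close>

lemma weighted_moment_recurrence:
  defines "I k m \<equiv> integral {-1..1} (\<lambda>x::real. x ^ m * sqrt (1 - x\<^sup>2) ^ k)"
  shows "I k 1 = 0"
    and "(real m + 1) * I k m = (real m + real k + 3) * I k (m + 2)"
proof -
  have int: "((\<lambda>x. x ^ m * sqrt (1 - x\<^sup>2) ^ k) has_integral I k m) {-1..1}" for k m
    unfolding I_def by (intro integrable_integral integrable_continuous_interval continuous_intros)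
  \<comment> \<open>Interior points only, since \<open>sqrt\<close> is not differentiable at 0; the
    interior form of the fundamental theorem suffices.\<close>
  have deriv: "((\<lambda>x. sqrt (1 - x\<^sup>2) ^ (k + 2)) has_real_derivative
      - (real k + 2) * x * sqrt (1 - x\<^sup>2) ^ k) (at x)" if "x \<in> {-1<..<1}" for x :: real and k
  proof -
    have "x\<^sup>2 < 1" using that by (simp add: abs_square_less_1 abs_less_iff)
    hence pos: "sqrt (1 - x\<^sup>2) > 0" by simp
    have "((\<lambda>x. sqrt (1 - x\<^sup>2)) has_real_derivative (- x / sqrt (1 - x\<^sup>2))) (at x)"
      using pos by (auto intro!: derivative_eq_intros simp: divide_simps)
    from DERIV_power[OF this, of "k + 2"] show ?thesis
      using pos by (simp add: divide_simps) (simp add: algebra_simps)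
  qed
  have "((\<lambda>x. - (real k + 2) * x * sqrt (1 - x\<^sup>2) ^ k) has_integral
      (sqrt (1 - 1\<^sup>2) ^ (k + 2) - sqrt (1 - (-1)\<^sup>2) ^ (k + 2))) {-1..1}"
    by (intro fundamental_theorem_of_calculus_interior continuous_intros
          has_real_derivative_iff_has_vector_derivative[THEN iffD1] deriv) auto
  hence "((\<lambda>x. - (real k + 2) * x * sqrt (1 - x\<^sup>2) ^ k) has_integral 0) {-1..1}" by simp
  moreover have "((\<lambda>x. - (real k + 2) * x * sqrt (1 - x\<^sup>2) ^ k) has_integral (- (real k + 2)) * I k 1) {-1..1}"
    using has_integral_mult_right[OF int[of 1 k], of "- (real k + 2)"] by (simp add: algebra_simps)
  ultimately have "(- (real k + 2)) * I k 1 = 0" by (rule has_integral_unique[symmetric])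
  moreover have "- (real k + 2) \<noteq> 0" by linarith
  ultimately show "I k 1 = 0" by simp
  let ?g = "\<lambda>x. (real m + 1) * x ^ m * sqrt (1 - x\<^sup>2) ^ k - (real m + real k + 3) * x ^ (m + 2) * sqrt (1 - x\<^sup>2) ^ k"
  have "(?g has_integral
      (1 ^ (m + 1) * sqrt (1 - 1\<^sup>2) ^ (k + 2) - (-1) ^ (m + 1) * sqrt (1 - (-1)\<^sup>2) ^ (k + 2))) {-1..1}"
  proof (rule fundamental_theorem_of_calculus_interior)
    fix x :: real assume x: "x \<in> {-1<..<1}"
    hence x2: "x\<^sup>2 < 1" by (simp add: abs_square_less_1 abs_less_iff)
    have s: "sqrt (1 - x\<^sup>2) ^ (k + 2) = (1 - x\<^sup>2) * sqrt (1 - x\<^sup>2) ^ k"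
      using x2 by (simp add: power_add)
    have "((\<lambda>x. x ^ (m + 1) * sqrt (1 - x\<^sup>2) ^ (k + 2)) has_real_derivative
        (real m + 1) * x ^ m * sqrt (1 - x\<^sup>2) ^ (k + 2)
        + - (real k + 2) * x * sqrt (1 - x\<^sup>2) ^ k * x ^ (m + 1)) (at x)"
      using DERIV_mult'[OF DERIV_pow[of "m + 1" x] deriv[OF x, of k]]
      by (simp add: algebra_simps)
    also have "(real m + 1) * x ^ m * sqrt (1 - x\<^sup>2) ^ (k + 2)
        + - (real k + 2) * x * sqrt (1 - x\<^sup>2) ^ k * x ^ (m + 1) = ?g x"
      unfolding s by (simp add: algebra_simps power2_eq_square)
    finally show "((\<lambda>x. x ^ (m + 1) * sqrt (1 - x\<^sup>2) ^ (k + 2)) has_vector_derivative ?g x) (at x)"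
      by (simp only: has_real_derivative_iff_has_vector_derivative)
  qed (auto intro!: continuous_intros)
  hence "(?g has_integral 0) {-1..1}" by simp
  moreover have "(?g has_integral ((real m + 1) * I k m - (real m + real k + 3) * I k (m + 2))) {-1..1}"
    using has_integral_diff[OF has_integral_mult_right[OF int[of m k], of "real m + 1"]
        has_integral_mult_right[OF int[of "m + 2" k], of "real m + real k + 3"]]
    by (simp add: mult.assoc)
  ultimately have "(real m + 1) * I k m - (real m + real k + 3) * I k (m + 2) = 0"
    by (rule has_integral_unique[symmetric])
  thus "(real m + 1) * I k m = (real m + real k + 3) * I k (m + 2)" by simp
qed

text \<open>The integral that appears in computing the volume of balls, carried over from the
  Lebesgue to the gauge integral.\<close>

lemma integral_sqrt_power:
  "integral {-1..1} (\<lambda>x::real. sqrt (1 - x\<^sup>2) ^ k) = Beta (1 / 2) (real k / 2 + 1)"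
proof -
  let ?f = "\<lambda>x::real. indicator {-1..1} x * sqrt (1 - x\<^sup>2) ^ k"
  have c: "continuous_on {-1..1::real} (\<lambda>x. sqrt (1 - x\<^sup>2) ^ k)" by (intro continuous_intros)
  have "(?f has_integral Beta (1 / 2) (real k / 2 + 1)) UNIV"
  proof (rule nn_integral_has_integral)
    show "?f \<in> borel_measurable borel" by measurable
    show "0 \<le> ?f x" for x by (auto simp: indicator_def abs_square_le_1)
    show "(\<integral>\<^sup>+ x. ennreal (?f x) \<partial>lborel) = ennreal (Beta (1 / 2) (real k / 2 + 1))"
      by (rule emeasure_cball_aux_integral)
    show "0 \<le> Beta (1 / 2) (real k / 2 + 1 :: real)" by (simp add: Beta_def Gamma_real_pos less_imp_le)
  qed
  hence "((\<lambda>x. if x \<in> {-1..1} then sqrt (1 - x\<^sup>2) ^ k else 0) has_integral Beta (1 / 2) (real k / 2 + 1)) UNIV"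
    by (rule has_integral_eq_rhs[OF has_integral_eq[rotated]]) (auto simp: indicator_def)
  thus ?thesis by (simp only: has_integral_restrict_UNIV integral_unique)
qed

section \<open>Moments of the Gegenbauer polynomials\<close>

text \<open>The quotient of areas normalises the weight to total mass 1 for
  \<open>d \<ge> 2\<close>. The weight is written as a natural power of a square root, so that the
  integrand is continuous up to the endpoints.\<close>

definition gegenbauer_moment :: "nat \<Rightarrow> nat \<Rightarrow> nat \<Rightarrow> real" where
  "gegenbauer_moment d n m = sphere_area (d - 1) / sphere_area d *
     integral {-1..1} (\<lambda>x. x ^ m * gegenbauer ((real d - 1) / 2) n x * sqrt (1 - x\<^sup>2) ^ (d - 2))"

lemma has_integral_gegenbauer_moment:
  "((\<lambda>x. sphere_area (d - 1) / sphere_area d *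
      (x ^ m * gegenbauer ((real d - 1) / 2) n x * sqrt (1 - x\<^sup>2) ^ (d - 2)))
    has_integral gegenbauer_moment d n m) {-1..1}"
  unfolding gegenbauer_moment_def
  by (intro has_integral_mult_right integrable_integral integrable_continuous_interval
        continuous_intros continuous_on_gegenbauer)

lemma gegenbauer_moment_1: "gegenbauer_moment d (Suc 0) m = (real d - 1) * gegenbauer_moment d 0 (Suc m)"
proof (rule has_integral_unique[OF has_integral_gegenbauer_moment])
  let ?c = "sphere_area (d - 1) / sphere_area d" and ?lam = "(real d - 1) / 2"
  show "((\<lambda>x. ?c * (x ^ m * gegenbauer ?lam (Suc 0) x * sqrt (1 - x\<^sup>2) ^ (d - 2)))
    has_integral (real d - 1) * gegenbauer_moment d 0 (Suc m)) {-1..1}"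
  proof (rule has_integral_eq[OF _ has_integral_mult_right[OF has_integral_gegenbauer_moment]])
    fix x :: real assume "x \<in> {-1..1}"
    hence x: "\<bar>x\<bar> \<le> 1" by auto
    show "(real d - 1) * (?c * (x ^ Suc m * gegenbauer ?lam 0 x * sqrt (1 - x\<^sup>2) ^ (d - 2))) =
        ?c * (x ^ m * gegenbauer ?lam (Suc 0) x * sqrt (1 - x\<^sup>2) ^ (d - 2))"
      unfolding gegenbauer_0[OF x] gegenbauer_1[OF x] by (simp add: divide_simps)
  qed
qed

text \<open>The three-term recurrence with \<open>2 * lam = d - 1\<close>, integrated against
  \<open>x ^ m\<close> and the weight.\<close>

lemma gegenbauer_moment_Suc_Suc:
  "(real n + 2) * gegenbauer_moment d (Suc (Suc n)) m =
     (2 * real n + real d + 1) * gegenbauer_moment d (Suc n) (Suc m)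
     - (real n + real d - 1) * gegenbauer_moment d n m"
proof (rule has_integral_unique[OF has_integral_mult_right[OF has_integral_gegenbauer_moment]])
  let ?c = "sphere_area (d - 1) / sphere_area d" and ?lam = "(real d - 1) / 2"
  show "((\<lambda>x. (real n + 2) * (?c * (x ^ m * gegenbauer ?lam (Suc (Suc n)) x * sqrt (1 - x\<^sup>2) ^ (d - 2))))
    has_integral ((2 * real n + real d + 1) * gegenbauer_moment d (Suc n) (Suc m)
     - (real n + real d - 1) * gegenbauer_moment d n m)) {-1..1}"
  proof (rule has_integral_eq[OF _ has_integral_diff[OF
          has_integral_mult_right[OF has_integral_gegenbauer_moment, of "2 * real n + real d + 1"]
          has_integral_mult_right[OF has_integral_gegenbauer_moment, of "real n + real d - 1"]]])
    fix x :: real assume "x \<in> {-1..1}"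
    hence x: "\<bar>x\<bar> \<le> 1" by auto
    have "2 * (real n + 1 + ?lam) = 2 * real n + real d + 1" "real n + 2 * ?lam = real n + real d - 1"
      by (simp_all add: field_simps)
    hence rec: "(real n + 2) * gegenbauer ?lam (Suc (Suc n)) x =
        (2 * real n + real d + 1) * x * gegenbauer ?lam (Suc n) x
          - (real n + real d - 1) * gegenbauer ?lam n x"
      using gegenbauer_Suc_Suc[OF x, of n ?lam] by metis
    have "A * (c * (x * y * g1 * w)) - B * (c * (y * g0 * w)) = N * (c * (y * g2 * w))"
      if "N * g2 = A * x * g1 - B * g0" for A B N g0 g1 g2 c w y :: real
      using that by algebra
    from this[OF rec, of _ "x ^ m", folded power_Suc]
    show "(2 * real n + real d + 1) * (?c * (x ^ Suc m * gegenbauer ?lam (Suc n) x * sqrt (1 - x\<^sup>2) ^ (d - 2)))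
        - (real n + real d - 1) * (?c * (x ^ m * gegenbauer ?lam n x * sqrt (1 - x\<^sup>2) ^ (d - 2)))
        = (real n + 2) * (?c * (x ^ m * gegenbauer ?lam (Suc (Suc n)) x * sqrt (1 - x\<^sup>2) ^ (d - 2)))" .
  qed
qed

text \<open>The recurrence of the weight moments steps by 2, so it remains to start it at 1 and at
  0; at 0 the Beta integral cancels the quotient of areas.\<close>

lemma gegenbauer_moment_0:
  assumes d: "d \<ge> 2"
  shows "odd m \<Longrightarrow> gegenbauer_moment d 0 m = 0"
    and "gegenbauer_moment d 0 (2 * j) =
      fact (2 * j) / (2 ^ (2 * j) * fact j * pochhammer ((real d + 1) / 2) j)"
proof -
  let ?c = "sphere_area (d - 1) / sphere_area d"
  have eq: "gegenbauer_moment d 0 m = ?c * integral {-1..1} (\<lambda>x. x ^ m * sqrt (1 - x\<^sup>2) ^ (d - 2))" for m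
    unfolding gegenbauer_moment_def
    by (intro arg_cong[where f = "(*) ?c"] integral_cong) (auto simp: gegenbauer_0)
  have rec: "(real m + 1) * gegenbauer_moment d 0 m = (real m + real d + 1) * gegenbauer_moment d 0 (m + 2)" for m
    using weighted_moment_recurrence(2)[of m "d - 2"] d by (simp add: eq of_nat_diff)
  show "gegenbauer_moment d 0 m = 0" if "odd m"
  proof -
    have "gegenbauer_moment d 0 (2 * k + 1) = 0" for k
    proof (induction k)
      case 0
      thus ?case using weighted_moment_recurrence(1)[of "d - 2"] by (simp add: eq)
    next
      case (Suc k)
      thus ?case using rec[of "2 * k + 1"] by (auto simp: add_eq_0_iff_both_eq_0)
    qed
    thus ?thesis using that by (auto elim: oddE)
  qed
  show "gegenbauer_moment d 0 (2 * j) =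
      fact (2 * j) / (2 ^ (2 * j) * fact j * pochhammer ((real d + 1) / 2) j)"
  proof (induction j)
    case 0
    have "Gamma (real d / 2) > 0" "Gamma ((real d + 1) / 2) > 0"
      using d by (auto intro!: Gamma_real_pos)
    hence "Gamma (real d / 2) \<noteq> 0" "Gamma ((real d + 1) / 2) \<noteq> 0" by (metis less_irrefl)+
    moreover have "pi powr ((real d + 1) / 2) = pi powr (real d / 2) * sqrt pi"
      by (simp add: add_divide_distrib powr_add powr_half_sqrt)
    moreover have "Beta (1 / 2) (real (d - 2) / 2 + 1) =
        sqrt pi * Gamma (real d / 2) / Gamma ((real d + 1) / 2)"
    proof -
      have "real (d - 2) / 2 + 1 = real d / 2" "1 / 2 + real d / 2 = (real d + 1) / 2"
        using d by (simp_all add: of_nat_diff field_simps)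
      thus ?thesis by (simp only: Beta_def Gamma_one_half_real)
    qed
    ultimately show ?case
      using d by (simp add: eq integral_sqrt_power sphere_area_def of_nat_diff)
  next
    case (Suc j)
    have p: "pochhammer ((real d + 1) / 2) j > 0" by (intro pochhammer_pos) auto
    have "(real (2 * j) + real d + 1) * gegenbauer_moment d 0 (2 * Suc j) =
        (real (2 * j) + 1) * (fact (2 * j) / (2 ^ (2 * j) * fact j * pochhammer ((real d + 1) / 2) j))"
      using rec[of "2 * j"] Suc by simp
    also have "\<dots> = (real (2 * j) + real d + 1) * (fact (2 * Suc j) / (2 ^ (2 * Suc j) * fact (Suc j) *
        pochhammer ((real d + 1) / 2) (Suc j)))"
      using p by (simp add: pochhammer_rec' divide_simps) (simp add: algebra_simps)
    finally have "(real (2 * j) + real d + 1) * gegenbauer_moment d 0 (2 * Suc j) = \<dots>" .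
    moreover have "real (2 * j) + real d + 1 \<noteq> 0" by linarith
    ultimately show ?case using mult_left_cancel by blast
  qed
qed

text \<open>Orthogonality to lower powers and the closed form are proved together by two-step
  induction on \<open>n\<close>: the closed form \<open>V\<close> satisfies the recurrence of
  \<open>gegenbauer_moment_Suc_Suc\<close>.\<close>

lemma gegenbauer_moment_eq_0:
  assumes d: "d \<ge> 2"
  shows "m < n \<or> odd (m + n) \<Longrightarrow> gegenbauer_moment d n m = 0"
    and gegenbauer_moment_nonzero: "gegenbauer_moment d n (n + 2 * j) =
      pochhammer (real d - 1) n / fact n * (fact (n + 2 * j) /
        (2 ^ (n + 2 * j) * fact j * pochhammer ((real d + 1) / 2) (n + j)))"
proof -
  define V where "V = (\<lambda>n j. pochhammer (real d - 1) n / fact n * (fact (n + 2 * j) /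
        (2 ^ (n + 2 * j) * fact j * pochhammer ((real d + 1) / 2) (n + j))))"
  have pos: "pochhammer ((real d + 1) / 2) k > 0" for k by (intro pochhammer_pos) auto
  have V_rec: "(real n + 2) * V (Suc (Suc n)) j =
      (2 * real n + real d + 1) * V (Suc n) (Suc j) - (real n + real d - 1) * V n (Suc j)" for n j
  proof -
    \<comment> \<open>\<open>E\<close> collects what the three terms of the recurrence share, and
      \<open>R\<close> is the extra Pochhammer factor in two of them; a polynomial identity
      remains.\<close>
    define E where "E = pochhammer (real d - 1) n / fact n * (fact (n + 2 * j + 2) /
        (2 ^ (n + 2 * j + 2) * fact j * pochhammer ((real d + 1) / 2) (n + j + 1)))"
    define R where "R = (real d + 1) / 2 + real n + real j + 1"
    have R: "R > 0" by (auto simp: R_def intro!: add_nonneg_pos)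
    have 0: "V n (Suc j) = E / (real j + 1)"
      by (simp add: V_def E_def mult_ac add_ac)
    have 1: "V (Suc n) (Suc j) =
        E * (real d - 1 + real n) * (real n + 2 * real j + 3) / (2 * (real n + 1) * (real j + 1) * R)"
      using R pos[of "Suc (n + j)"]
      by (simp add: V_def E_def R_def pochhammer_rec'[of _ n] pochhammer_rec'[of _ "Suc (n + j)"])
         (simp add: divide_simps; simp add: algebra_simps)
    have 2: "V (Suc (Suc n)) j =
        E * (real d - 1 + real n) * (real d + real n) / ((real n + 2) * (real n + 1) * R)"
      using R pos[of "Suc (n + j)"]
      by (simp add: V_def E_def R_def pochhammer_rec'[of _ n] pochhammer_rec'[of _ "Suc n"]
            pochhammer_rec'[of _ "Suc (n + j)"])
         (simp add: divide_simps; simp add: algebra_simps)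
    have nz: "real n + 2 \<noteq> 0" "real n + 1 \<noteq> 0" "real j + 1 \<noteq> 0" "R \<noteq> 0" using R by linarith+
    have "2 * R = real d + 2 * real n + 2 * real j + 3" by (simp add: R_def field_simps)
    hence "(real d + real n) * (2 * (real j + 1)) =
        (2 * real n + real d + 1) * (real n + 2 * real j + 3) - 2 * (real n + 1) * R" by algebra
    thus ?thesis unfolding 0 1 2 using nz by (simp add: divide_simps) algebra
  qed
  \<comment> \<open>Needed for \<open>m = n\<close> in the vanishing part, where the two terms of
    the recurrence are not zero separately but cancel.\<close>
  have V_0: "(2 * real n + real d + 1) * V (Suc n) 0 = (real n + real d - 1) * V n 0" for n
  proof -
    have "(real d + 1) / 2 + real n > 0" by (auto intro!: add_pos_nonneg)
    thus ?thesis using pos[of n]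
      by (simp add: V_def pochhammer_rec') (simp add: divide_simps; simp add: algebra_simps)
  qed
  have "(\<forall>m. m < n \<or> odd (m + n) \<longrightarrow> gegenbauer_moment d n m = 0) \<and>
      (\<forall>j. gegenbauer_moment d n (n + 2 * j) = V n j)"
  proof (induction n rule: induct_nat_012)
    case 0
    thus ?case using gegenbauer_moment_0[OF d] by (simp add: V_def)
  next
    case 1
    have "gegenbauer_moment d (Suc 0) (Suc 0 + 2 * j) = V (Suc 0) j" for j
    proof -
      have "V 0 (Suc j) * (real d - 1) = V (Suc 0) j"
        using pos[of "Suc j"] by (simp add: V_def) (simp add: divide_simps; simp add: algebra_simps)
      thus ?thesis using gegenbauer_moment_0(2)[OF d, of "Suc j"]
        by (simp add: gegenbauer_moment_1 V_def mult.commute)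
    qed
    moreover have "gegenbauer_moment d (Suc 0) m = 0" if "m < Suc 0 \<or> odd (m + Suc 0)" for m
      using that gegenbauer_moment_0(1)[OF d, of "Suc m"] by (auto simp: gegenbauer_moment_1)
    ultimately show ?case by blast
  next
    case (ge2 n)
    have n2: "real n + 2 \<noteq> 0" by linarith
    have "gegenbauer_moment d (Suc (Suc n)) (Suc (Suc n) + 2 * j) = V (Suc (Suc n)) j" for j
    proof -
      have e: "Suc (Suc n) + 2 * j = n + 2 * Suc j" "Suc (n + 2 * Suc j) = Suc n + 2 * Suc j"
        by simp_all
      have "(real n + 2) * gegenbauer_moment d (Suc (Suc n)) (Suc (Suc n) + 2 * j) =
          (real n + 2) * V (Suc (Suc n)) j"
        unfolding V_rec gegenbauer_moment_Suc_Suc unfolding e using ge2 by metis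
      thus ?thesis using n2 mult_left_cancel by blast
    qed
    moreover have "gegenbauer_moment d (Suc (Suc n)) m = 0"
      if m: "m < Suc (Suc n) \<or> odd (m + Suc (Suc n))" for m
    proof -
      have "(real n + 2) * gegenbauer_moment d (Suc (Suc n)) m = 0"
      proof (cases "m = n")
        case True
        have "gegenbauer_moment d n n = V n 0" "gegenbauer_moment d (Suc n) (Suc n) = V (Suc n) 0"
          using ge2 by (metis add_0_right mult_0_right)+
        thus ?thesis unfolding gegenbauer_moment_Suc_Suc True using V_0[of n] by simp
      next
        case False
        hence "m < n \<or> odd (m + n)" "Suc m < Suc n \<or> odd (Suc m + Suc n)" using m by presburger+
        hence "gegenbauer_moment d n m = 0" "gegenbauer_moment d (Suc n) (Suc m) = 0"
          using ge2 by blast+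
        thus ?thesis by (simp add: gegenbauer_moment_Suc_Suc)
      qed
      thus ?thesis using n2 by simp
    qed
    ultimately show ?case by blast
  qed
  thus "m < n \<or> odd (m + n) \<Longrightarrow> gegenbauer_moment d n m = 0"
    and "gegenbauer_moment d n (n + 2 * j) =
      pochhammer (real d - 1) n / fact n * (fact (n + 2 * j) /
        (2 ^ (n + 2 * j) * fact j * pochhammer ((real d + 1) / 2) (n + j)))"
    unfolding V_def by blast+
qed

section \<open>Expansion of monomials in normalised Gegenbauer polynomials\<close>

text \<open>The coefficient of \<open>c_poly n d\<close> in the expansion of \<open>x\<^sup>m\<close>.\<close>

definition monomial_coeff :: "nat \<Rightarrow> nat \<Rightarrow> nat \<Rightarrow> real" where
  "monomial_coeff d n m =
     harmonic_dim n d / gegenbauer ((real d - 1) / 2) n 1 * gegenbauer_moment d n m"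

lemma monomial_coeff_eq_0: "d \<ge> 2 \<Longrightarrow> m < n \<or> odd (m + n) \<Longrightarrow> monomial_coeff d n m = 0"
  by (simp add: monomial_coeff_def gegenbauer_moment_eq_0)

text \<open>The value of the Gegenbauer polynomial at 1 cancels the first factor of its
  moment.\<close>

lemma monomial_coeff_nonzero:
  assumes "d \<ge> 2"
  shows "monomial_coeff d n (n + 2 * j) = harmonic_dim n d *
    (fact (n + 2 * j) / (2 ^ (n + 2 * j) * fact j * pochhammer ((real d + 1) / 2) (n + j)))"
proof -
  have "pochhammer (real d - 1) n > 0" using assms by (intro pochhammer_pos) auto
  moreover have "gegenbauer ((real d - 1) / 2) n 1 = pochhammer (real d - 1) n / fact n"
    unfolding gegenbauer_at_1 by (simp only: nonzero_mult_div_cancel_left times_divide_eq_right)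
  ultimately show ?thesis
    by (simp add: monomial_coeff_def gegenbauer_moment_nonzero[OF assms])
qed

lemma monomial_coeff_nonneg:
  assumes "d \<ge> 2"
  shows "monomial_coeff d n m \<ge> 0"
proof (cases "m < n \<or> odd (m + n)")
  case True
  thus ?thesis using monomial_coeff_eq_0[OF assms] by simp
next
  case False
  hence "m = n + 2 * ((m - n) div 2)" by (auto elim!: evenE)
  moreover have "harmonic_dim n d \<ge> 0"
    using assms by (auto simp: harmonic_dim_def intro!: mult_nonneg_nonneg divide_nonneg_nonneg pochhammer_nonneg)
  moreover have "pochhammer ((real d + 1) / 2) k > 0" for k by (intro pochhammer_pos) auto
  ultimately show ?thesis using monomial_coeff_nonzero[OF assms]
    by (metis divide_nonneg_nonneg fact_ge_zero less_imp_le mult_nonneg_nonneg zero_le_numeral zero_le_power)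
qed

text \<open>Doubling each Pochhammer factor in the denominator produces
  \<open>d + 1 + 2 * i\<close>, and the last of these cancels the linear factor of
  \<open>harmonic_dim\<close>. In this form every factor is visibly at most 1 and tends to
  1.\<close>

lemma monomial_coeff_diag:
  assumes "d \<ge> 2"
  shows "monomial_coeff d n n = (\<Prod>i<n - 1. (real d + real i) / (real d + 1 + 2 * real i))"
proof (cases n)
  case 0
  thus ?thesis using monomial_coeff_nonzero[OF assms, of 0 0] by (simp add: harmonic_dim_def)
next
  case (Suc k)
  have "2 ^ n * pochhammer ((real d + 1) / 2) n = (\<Prod>i<n. 2) * (\<Prod>i<n. (real d + 1) / 2 + real i)"
    by (simp add: pochhammer_prod atLeast0LessThan)
  also have "\<dots> = (\<Prod>i<n. real d + 1 + 2 * real i)"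
    unfolding prod.distrib[symmetric] by (intro prod.cong) (auto simp: field_simps)
  also have "\<dots> = (\<Prod>i<k. real d + 1 + 2 * real i) * (real d + 1 + 2 * real k)"
    by (simp add: Suc)
  finally have eq: "2 ^ n * pochhammer ((real d + 1) / 2) n = \<dots>" .
  have nz: "real d + 1 + 2 * real k \<noteq> 0" by linarith
  have last: "2 * real n + real d - 1 = real d + 1 + 2 * real k" by (simp add: Suc)
  have "monomial_coeff d n n =
      pochhammer (real d) k * (2 * real n + real d - 1) / (2 ^ n * pochhammer ((real d + 1) / 2) n)"
    using monomial_coeff_nonzero[OF assms, of n 0] by (simp add: harmonic_dim_def Suc)
  also have "\<dots> = pochhammer (real d) k / (\<Prod>i<k. real d + 1 + 2 * real i)"
    unfolding eq last using nz by (rule nonzero_mult_divide_mult_cancel_right)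
  finally show ?thesis
    by (simp add: Suc prod_dividef pochhammer_prod atLeast0LessThan)
qed

text \<open>The quotient of successive closed forms is of order 1/d; it gives monotonicity in
  \<open>j\<close> as well as decay in \<open>d\<close>.\<close>

lemma monomial_coeff_Suc:
  assumes "d \<ge> 2"
  shows "monomial_coeff d n (n + 2 * Suc j) = monomial_coeff d n (n + 2 * j) *
    ((real n + 2 * real j + 1) * (real n + 2 * real j + 2) /
     (2 * (real j + 1) * (real d + 1 + 2 * real n + 2 * real j)))"
proof -
  have "pochhammer ((real d + 1) / 2) (n + j) > 0" by (intro pochhammer_pos) auto
  moreover have "real d + 1 + 2 * real n + 2 * real j \<noteq> 0" by linarith
  moreover have "(real d + 1) / 2 + real n + real j = (real d + 1 + 2 * real n + 2 * real j) / 2"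
    by (simp add: field_simps)
  ultimately show ?thesis
    unfolding monomial_coeff_nonzero[OF assms]
    by (simp add: pochhammer_rec' add.assoc) (simp add: divide_simps; simp add: algebra_simps)
qed

text \<open>The threshold \<open>(n + 2)\<^sup>2\<close> is a convenient size that does not depend
  on \<open>j\<close>: with it the denominator of the quotient dominates the numerator
  coefficientwise in \<open>n\<close> and \<open>j\<close>.\<close>

lemma monomial_coeff_decreasing:
  assumes d: "d \<ge> 2" and large: "real d \<ge> (real n + 2)\<^sup>2"
  shows "monomial_coeff d n (n + 2 * Suc j) \<le> monomial_coeff d n (n + 2 * j)"
proof -
  have "(real n + 2 * real j + 1) * (real n + 2 * real j + 2) \<le>
      2 * (real j + 1) * ((real n + 2)\<^sup>2 + 1 + 2 * real n + 2 * real j)"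
    by (simp add: power2_eq_square algebra_simps)
  also have "\<dots> \<le> 2 * (real j + 1) * (real d + 1 + 2 * real n + 2 * real j)"
    using large by (intro mult_left_mono) auto
  finally have "(real n + 2 * real j + 1) * (real n + 2 * real j + 2) /
     (2 * (real j + 1) * (real d + 1 + 2 * real n + 2 * real j)) \<le> 1"
    by (subst divide_le_eq_1_pos) (auto intro!: mult_pos_pos add_nonneg_pos add_pos_nonneg)
  thus ?thesis unfolding monomial_coeff_Suc[OF d]
    using monomial_coeff_nonneg[OF d, of n "n + 2 * j"] by (metis mult.right_neutral mult_left_mono)
qed

text \<open>The diagonal coefficient is at most 1 and the later ones decrease from it. The bound is
  uniform in \<open>m\<close>, as a dominated limit in \<open>d\<close> requires.\<close>

lemma monomial_coeff_le_1:
  assumes d: "d \<ge> 2" and large: "real d \<ge> (real n + 2)\<^sup>2"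
  shows "monomial_coeff d n m \<le> 1"
proof (cases "m < n \<or> odd (m + n)")
  case True
  thus ?thesis using monomial_coeff_eq_0[OF d] by simp
next
  case False
  hence m: "m = n + 2 * ((m - n) div 2)" by (auto elim!: evenE)
  have "monomial_coeff d n n \<le> (\<Prod>i<n - 1. 1)"
    unfolding monomial_coeff_diag[OF d] by (intro prod_mono) (auto simp: divide_simps)
  hence "monomial_coeff d n (n + 2 * j) \<le> 1" for j
    by (induction j) (use monomial_coeff_decreasing[OF d large] in \<open>auto intro: order_trans\<close>)
  thus ?thesis using m by metis
qed

lemma monomial_coeff_tendsto:
  "(\<lambda>d. monomial_coeff d n m) \<longlonglongrightarrow> (if m = n then 1 else 0)"
proof -
  have large: "\<forall>\<^sub>F d in sequentially. d \<ge> 2 \<and> real d \<ge> (real n + 2)\<^sup>2"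
    using eventually_ge_at_top[of 2] eventually_ge_at_top[of "nat \<lceil>(real n + 2)\<^sup>2\<rceil>"]
    by eventually_elim (auto simp: nat_le_iff ceiling_le_iff)
  have at_top: "filterlim (\<lambda>d. b + real d) at_top sequentially" for b
    by (rule filterlim_tendsto_add_at_top[OF tendsto_const filterlim_real_sequentially])
  have factor: "(\<lambda>d. (real d + real i) / (real d + 1 + 2 * real i)) \<longlonglongrightarrow> 1" for i
  proof -
    have "(\<lambda>d. 1 - (1 + real i) / (1 + 2 * real i + real d)) \<longlonglongrightarrow> 1 - 0"
      by (intro tendsto_diff tendsto_const real_tendsto_divide_at_top[OF tendsto_const at_top])
    moreover have "1 - (1 + real i) / (1 + 2 * real i + real d) =
        (real d + real i) / (real d + 1 + 2 * real i)" for d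
      by (simp add: divide_simps) (simp add: algebra_simps)
    ultimately show ?thesis by simp
  qed
  have "(\<lambda>d. \<Prod>i<n - 1. (real d + real i) / (real d + 1 + 2 * real i)) \<longlonglongrightarrow> (\<Prod>i<n - 1. 1)"
    by (intro tendsto_prod factor)
  hence "(\<lambda>d. \<Prod>i<n - 1. (real d + real i) / (real d + 1 + 2 * real i)) \<longlonglongrightarrow> 1" by simp
  hence diag: "(\<lambda>d. monomial_coeff d n n) \<longlonglongrightarrow> 1"
    by (rule Lim_transform_eventually[OF _ eventually_mono[OF large]]) (auto simp: monomial_coeff_diag)
  show ?thesis
  proof (cases "m < n \<or> odd (m + n)")
    case True
    have "\<forall>\<^sub>F d in sequentially. monomial_coeff d n m = 0"
      using large by eventually_elim (use True in \<open>simp add: monomial_coeff_eq_0\<close>)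
    thus ?thesis using True by (auto simp: tendsto_eventually)
  next
    case False
    hence "m = n + 2 * ((m - n) div 2)" by (auto elim!: evenE)
    then obtain j where m: "m = n + 2 * j" by blast
    show ?thesis
    proof (cases j)
      case 0
      thus ?thesis using diag m by simp
    next
      \<comment> \<open>By monotonicity the coefficient with \<open>j = 1\<close> bounds all later
        ones, and it is the diagonal coefficient times a quantity of order 1/d.\<close>
      case (Suc i)
      have "(\<lambda>d. monomial_coeff d n (n + 2 * j)) \<longlonglongrightarrow> 0"
      proof (rule tendsto_sandwich[OF _ _ tendsto_const])
        show "\<forall>\<^sub>F d in sequentially. 0 \<le> monomial_coeff d n (n + 2 * j)"
          using large by eventually_elim (simp add: monomial_coeff_nonneg)
        show "\<forall>\<^sub>F d in sequentially. monomial_coeff d n (n + 2 * j) \<le> monomial_coeff d n n *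
            ((real n + 1) * (real n + 2) / (2 * (real d + 1 + 2 * real n)))"
          using large
        proof eventually_elim
          case (elim d)
          have "monomial_coeff d n (n + 2 * Suc i) \<le> monomial_coeff d n (n + 2 * Suc 0)"
            by (rule lift_Suc_antimono_le[of "\<lambda>k. monomial_coeff d n (n + 2 * k)"])
               (use elim monomial_coeff_decreasing in auto)
          thus ?case using monomial_coeff_Suc[of d n 0] elim by (simp add: Suc)
        qed
        have "(\<lambda>d. (real n + 1) * (real n + 2) / 2 / (1 + 2 * real n + real d)) \<longlonglongrightarrow> 0"
          by (rule real_tendsto_divide_at_top[OF tendsto_const at_top])
        hence "(\<lambda>d. (real n + 1) * (real n + 2) / (2 * (real d + 1 + 2 * real n))) \<longlonglongrightarrow> 0"
          by (simp add: add_ac)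
        from tendsto_mult[OF diag this]
        show "(\<lambda>d. monomial_coeff d n n *
            ((real n + 1) * (real n + 2) / (2 * (real d + 1 + 2 * real n)))) \<longlonglongrightarrow> 0" by simp
      qed
      thus ?thesis using m Suc by simp
    qed
  qed
qed

section \<open>Limits of the Schoenberg functions\<close>

text \<open>The expansion times the bounded function \<open>q\<close> converges uniformly, so it may
  be integrated term by term; each term yields a \<open>monomial_coeff\<close>.\<close>

lemma schoenberg_fun_sums:
  fixes G :: "('a, 'b) monoid_scheme" (structure)
  assumes G: "group G" and exp: "schoenberg_expansion G T f \<phi>" and u: "u \<in> carrier G" and d: "d \<ge> 3"
  shows "(\<lambda>m. \<phi> m u * of_real (monomial_coeff d n m)) sums schoenberg_fun f n d u"
proof -
  let ?lam = "(real d - 1) / 2"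
  define q where "q = (\<lambda>x. gegenbauer ?lam n x * sqrt (1 - x\<^sup>2) ^ (d - 2))"
  define I where "I = (\<lambda>m. integral {-1..1} (\<lambda>x. x ^ m * q x))"
  have q: "continuous_on {-1..1} q"
    unfolding q_def by (intro continuous_intros continuous_on_gegenbauer)
  have "bounded (q ` {-1..1})" by (intro compact_imp_bounded compact_continuous_image q) simp
  then obtain B where "\<forall>x\<in>{-1..1}. \<bar>q x\<bar> \<le> B" by (auto simp: bounded_iff)
  hence B: "\<bar>q x\<bar> \<le> B" if "x \<in> {-1..1}" for x using that by blast
  have unif: "uniform_limit {-1..1} (\<lambda>M x. \<Sum>m<M. \<phi> m u * of_real (x ^ m * q x))
      (\<lambda>x. \<Sum>m. \<phi> m u * of_real (x ^ m * q x)) sequentially"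
  proof (rule Weierstrass_m_test[OF _ summable_mult2[OF schoenberg_expansionD(3)[OF G exp], of B]])
    fix m and x :: real assume x: "x \<in> {-1..1}"
    have "\<bar>x\<bar> ^ m * \<bar>q x\<bar> \<le> 1 * B" using x B[OF x] by (intro mult_mono power_le_one) auto
    hence "norm (\<phi> m u) * (\<bar>x\<bar> ^ m * \<bar>q x\<bar>) \<le> Re (\<phi> m \<one>) * B"
      using schoenberg_expansionD(2)[OF G exp u, of m]
      by (intro mult_mono) (auto intro: order_trans[OF norm_ge_zero])
    thus "norm (\<phi> m u * of_real (x ^ m * q x)) \<le> Re (\<phi> m \<one>) * B"
      by (simp add: norm_mult norm_power abs_mult power_abs)
  qed
  have suminf: "(\<Sum>m. \<phi> m u * of_real (x ^ m * q x)) = f (x, u) * of_real (q x)" if "x \<in> {-1..1}" for x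
    using sums_mult2[OF schoenberg_expansionD(4)[OF G exp that u], of "of_real (q x)"]
    by (simp add: sums_iff mult.assoc)
  have unif': "uniform_limit {-1..1} (\<lambda>M x. \<Sum>m<M. \<phi> m u * of_real (x ^ m * q x))
      (\<lambda>x. f (x, u) * of_real (q x)) sequentially"
    by (rule uniform_limit_cong'[THEN iffD1, OF _ _ unif]) (simp_all add: suminf del: of_real_mult)
  have Im: "((\<lambda>x. of_real (x ^ m * q x)) has_integral complex_of_real (I m)) {-1..1}" for m
    unfolding I_def
    by (intro has_integral_of_real integrable_integral integrable_continuous_interval continuous_intros q)
  have partial: "((\<lambda>x. \<Sum>m<M. \<phi> m u * of_real (x ^ m * q x)) has_integral (\<Sum>m<M. \<phi> m u * of_real (I m))) {-1..1}" for M
    by (intro has_integral_sum has_integral_mult_right Im) auto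
  obtain J K where J: "\<And>M. ((\<lambda>x. \<Sum>m<M. \<phi> m u * of_real (x ^ m * q x)) has_integral J M) {-1..1}"
    "((\<lambda>x. f (x, u) * of_real (q x)) has_integral K) {-1..1}" "J \<longlonglongrightarrow> K"
    by (rule uniform_limit_integral[OF unif']) (auto intro!: continuous_intros q)
  have "J = (\<lambda>M. \<Sum>m<M. \<phi> m u * of_real (I m))"
    using has_integral_unique[OF J(1) partial] by auto
  hence sums: "(\<lambda>m. \<phi> m u * of_real (I m)) sums K" using J(3) by (simp add: sums_def)
  \<comment> \<open>At the endpoints both sides are 0: the left by the convention for
    \<open>0 powr a\<close>, the right because \<open>d \<ge> 3\<close> makes the exponent
    positive.\<close>
  have weight: "(1 - x\<^sup>2) powr (real d / 2 - 1) = sqrt (1 - x\<^sup>2) ^ (d - 2)" if "x \<in> {-1..1}" for x :: real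
  proof (cases "1 - x\<^sup>2 = 0")
    case False
    moreover have "x\<^sup>2 \<le> 1" using that by (simp add: abs_square_le_1 abs_le_iff)
    ultimately have "1 - x\<^sup>2 > 0" by simp
    thus ?thesis using d
      by (simp add: powr_half_sqrt[symmetric] powr_realpow[symmetric] powr_powr of_nat_diff diff_divide_distrib)
  qed (use d in auto)
  let ?c = "harmonic_dim n d * sphere_area (d - 1) / sphere_area d" and ?g = "gegenbauer ?lam n 1"
  have "((\<lambda>x. f (x, u) * of_real (q x) / of_real ?g) has_integral K / of_real ?g) {-1..1}"
    by (rule has_integral_divide[OF J(2)])
  hence "((\<lambda>x. f (x, u) * of_real (c_poly n d x) * of_real ((1 - x\<^sup>2) powr (real d / 2 - 1)))
      has_integral K / of_real ?g) {-1..1}"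
    by (rule has_integral_eq[rotated]) (use d in \<open>simp add: weight q_def c_poly_def\<close>)
  hence "schoenberg_fun f n d u = of_real ?c * (K / of_real ?g)"
    unfolding schoenberg_fun_def by (simp only: integral_unique)
  moreover have "monomial_coeff d n m = ?c / ?g * I m" for m
    by (simp add: monomial_coeff_def gegenbauer_moment_def I_def q_def mult.assoc)
  ultimately show ?thesis
    using sums_mult[OF sums, of "of_real (?c / ?g)"] by (simp add: mult_ac)
qed

text \<open>Tannery's theorem: the majorant \<open>Re (\<phi> m \<one>)\<close> does not depend on
  \<open>d\<close>, and in the limit only the term \<open>m = n\<close> remains.\<close>

lemma schoenberg_fun_tendsto:
  fixes G :: "('a, 'b) monoid_scheme" (structure)
  assumes G: "group G" and exp: "schoenberg_expansion G T f \<phi>" and u: "u \<in> carrier G"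
  shows "(\<lambda>d. schoenberg_fun f n d u) \<longlonglongrightarrow> \<phi> n u"
proof -
  have large: "\<forall>\<^sub>F d in sequentially. d \<ge> 3 \<and> real d \<ge> (real n + 2)\<^sup>2"
    using eventually_ge_at_top[of 3] eventually_ge_at_top[of "nat \<lceil>(real n + 2)\<^sup>2\<rceil>"]
    by eventually_elim (auto simp: nat_le_iff ceiling_le_iff)
  have lim: "(\<lambda>d. \<phi> m u * of_real (monomial_coeff d n m)) \<longlonglongrightarrow> \<phi> m u * of_real (if m = n then 1 else 0)" for m
    by (intro tendsto_mult_left tendsto_of_real monomial_coeff_tendsto)
  have bound: "\<forall>\<^sub>F d in sequentially. \<forall>m. norm (\<phi> m u * of_real (monomial_coeff d n m)) \<le> Re (\<phi> m \<one>)"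
    using large
  proof eventually_elim
    case (elim d)
    show ?case
    proof
      fix m
      have "norm (\<phi> m u) * \<bar>monomial_coeff d n m\<bar> \<le> Re (\<phi> m \<one>) * 1"
        using elim monomial_coeff_nonneg[of d n m] monomial_coeff_le_1[of d n m]
          schoenberg_expansionD(2)[OF G exp u, of m]
        by (intro mult_mono) (auto intro: order_trans[OF norm_ge_zero])
      thus "norm (\<phi> m u * of_real (monomial_coeff d n m)) \<le> Re (\<phi> m \<one>)" by (simp add: norm_mult)
    qed
  qed
  have "\<forall>\<^sub>F (m, d) in sequentially \<times>\<^sub>F sequentially.
      norm (\<phi> m u * of_real (monomial_coeff d n m)) \<le> Re (\<phi> m \<one>)"
    unfolding eventually_prod_filter by (intro exI[of _ "\<lambda>_. True"] exI conjI, simp, rule bound) auto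
  from tannerys_theorem[OF lim this schoenberg_expansionD(3)[OF G exp]]
  have "(\<lambda>d. \<Sum>m. \<phi> m u * of_real (monomial_coeff d n m)) \<longlonglongrightarrow> (\<Sum>m. \<phi> m u * of_real (if m = n then 1 else 0))"
    by simp
  also have "(\<Sum>m. \<phi> m u * of_real (if m = n then 1 else 0)) = \<phi> n u"
    by (subst suminf_finite[of "{n}"]) auto
  finally show ?thesis
    by (rule Lim_transform_eventually)
       (use large in \<open>eventually_elim, simp add: sums_unique[OF schoenberg_fun_sums[OF G exp u]]\<close>)
qed

text \<open>Convergence and limit are claimed for every expanding sequence, so the limit formula
  also shows that the sequence is unique on the group.\<close>

theorem theorem3p10:
  fixes G :: "('a, 'b) monoid_scheme" and T :: "'a topology"
    and f :: "real \<times> 'a \<Rightarrow> complex"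
  assumes "locally_compact_group G T"
    and "continuous_map (prod_topology (top_of_set {-1..1}) T) euclidean f"
  shows "(f \<in> pos_def_sphere_inf G T \<longleftrightarrow> (\<exists>\<phi>. schoenberg_expansion G T f \<phi>)) \<and>
    (\<forall>\<phi>. schoenberg_expansion G T f \<phi> \<longrightarrow>
       uniform_limit ({0..pi} \<times> carrier G)
         (\<lambda>N (\<theta>, u). \<Sum>n<N. \<phi> n u * of_real (cos \<theta> ^ n)) (\<lambda>(\<theta>, u). f (cos \<theta>, u)) sequentially) \<and>
    (f \<in> pos_def_sphere_inf G T \<longrightarrow>
       (\<forall>\<phi>. schoenberg_expansion G T f \<phi> \<longrightarrow>
          (\<forall>n. \<forall>u\<in>carrier G. (\<lambda>d. schoenberg_fun f n d u) \<longlonglongrightarrow> \<phi> n u)))"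
proof -
  have G: "group G" and T: "topspace T = carrier G"
    using locally_compact_group.axioms(1) locally_compact_group.topspace_eq assms(1) by blast+
  have cos: "(\<lambda>(\<theta>, u). (cos \<theta>, u)) \<in> {0..pi} \<times> carrier G \<rightarrow> {-1..1} \<times> carrier G"
    by auto
  have "uniform_limit ({0..pi} \<times> carrier G)
      (\<lambda>N (\<theta>, u). \<Sum>n<N. \<phi> n u * of_real (cos \<theta> ^ n)) (\<lambda>(\<theta>, u). f (cos \<theta>, u)) sequentially"
    if "schoenberg_expansion G T f \<phi>" for \<phi>
    using uniform_limit_compose'[OF schoenberg_expansion_uniform_limit[OF G that] cos]
    by (simp add: case_prod_unfold)
  moreover have "f \<in> pos_def_sphere_inf G T" if "schoenberg_expansion G T f \<phi>" for \<phi>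
    using schoenberg_expansion_imp_pos_def_sphere[OF G assms(2) that] by (simp add: pos_def_sphere_inf_def)
  ultimately show ?thesis
    using pos_def_sphere_inf_imp_schoenberg_expansion[OF G T] schoenberg_fun_tendsto[OF G] by blast
qed

end
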